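(* Consider the problem $(P_1)$, its dual $(D_1)$ and the Primal-Dual Adaptive Similar Triangles Method (PDASTM) described in the context, with initial guess $L_0>0$, and let $L$ be the Lipschitz constant of $\nabla\varphi$. Assume that: (1) $f$ is $\gamma$-strongly convex on $Q$; (2) the inner problem $\max_{x\in Q}\left(-f(x)-\langle A_1^T\lambda^{(1)}+A_2^T\lambda^{(2)},x\rangle\right)$, whose unique solution is denoted $x(\lambda)$, is simple in the sense that it has a closed form solution or can be solved very fast up to machine precision (so that $x(\lambda)$ is treated as available exactly); (3) the dual problem $(D_1)$ has a solution $\lambda^*=(\lambda^{*(1)},\lambda^{*(2)})^T$ and $R_1,R_2>0$ are such that $\|\lambda^{*(1)}\|_2\le R_1<+\infty$, $\|\lambda^{*(2)}\|_2\le R_2<+\infty$. Then, for any $\tilde\varepsilon_f,\tilde\varepsilon_{eq},\tilde\varepsilon_{in}>0$, the algorithm stops not later than when $k$ equals $$\max\left\{\left\lceil\sqrt{\frac{16L(R_1^2+R_2^2)}{\tilde\varepsilon_f}}\right\rceil,\left\lceil\sqrt{\frac{16L(R_1^2+R_2^2)}{R_1\tilde\varepsilon_{eq}}}\right\rceil,\left\lceil\sqrt{\frac{16L(R_1^2+R_2^2)}{R_2\tilde\varepsilon_{in}}}\right\rceil\right\}.$$ Moreover, let $\varepsilon_f,\varepsilon_{eq},\varepsilon_{in}>0$. Then, not later than when $k$ equals $$\max\left\{\left\lceil\sqrt{\frac{32L(R_1^2+R_2^2)}{\varepsilon_f}}\right\rceil,\left\lceil\sqrt{\frac{16L(R_1^2+R_2^2)}{R_1\varepsilon_{eq}}}\right\rceil,\left\lceil\sqrt{\frac{16L(R_1^2+R_2^2)}{R_2\varepsilon_{in}}}\right\rceil\right\}$$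 (that is, for $k$ equal to this number, when the iterations are run without stopping), the point $\hat x_{k+1}$ generated by the algorithm is an $(\varepsilon_f,\varepsilon_{eq},\varepsilon_{in})$-solution to $(P_1)$, i.e. $$|f(\hat x_{k+1})-Opt[P_1]|\le\varepsilon_f,\qquad \|A_1\hat x_{k+1}-b_1\|_2\le\varepsilon_{eq},\qquad \rho(A_2\hat x_{k+1}-b_2,-K)\le\varepsilon_{in}.$$
   Context: Primal problem. $(P_1)$ is the convex problem $\min_{x\in Q\subseteq E}\{f(x): A_1x=b_1,\ A_2x-b_2\in -K\}$, with optimal value $Opt[P_1]$. Here $E$ is a finite-dimensional real vector space with a norm $\|\cdot\|_E$, $Q\subseteq E$ is closed and convex, $A_1:E\to H_1$ and $A_2:E\to H_2$ are linear operators into finite-dimensional Euclidean spaces (norms $\|\cdot\|_2$, also on the duals), $b_1\in H_1$, $b_2\in H_2$, and $K\subseteq H_2$ is a closed convex cone. $f$ is $\gamma$-strongly convex on $Q$ w.r.t. $\|\cdot\|_E$, $\gamma>0$: $f(y)\ge f(x)+\langle\nabla f(x),y-x\rangle+\frac{\gamma}{2}\|x-y\|_E^2$ for $x,y\in Q$ and any subgradient $\nabla f(x)$ of $f$ at $x$. $K^*=\{\lambda\in H_2^*:\langle\lambda,x\rangle\ge0\ \forall x\in K\}$ is the dual cone, and $A^T$ denotes the adjoint: $\langle u,Ax\rangle=\langle A^Tu,x\rangle$. The cone infeasibility measure is $\rho(v,-K)=\max_{\lambda^{(2)}\in K^*,\ \|\lambda^{(2)}\|_2\le1}\langle\lambda^{(2)},v\rangle$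 for $v\in H_2$. Dual problem. Let $\Lambda=\{\lambda=(\lambda^{(1)},\lambda^{(2)})^T\in H_1^*\times H_2^*:\lambda^{(2)}\in K^*\}$, and $$\varphi(\lambda)=\langle\lambda^{(1)},b_1\rangle+\langle\lambda^{(2)},b_2\rangle+\max_{x\in Q}\left(-f(x)-\langle A_1^T\lambda^{(1)}+A_2^T\lambda^{(2)},x\rangle\right).$$ The Lagrange dual $(D_1)$ is $\max_{\lambda\in\Lambda}(-\varphi(\lambda))$. With $x(\lambda)$ the unique maximizer in the definition of $\varphi(\lambda)$, the function $\varphi$ is convex and differentiable with $\nabla\varphi(\lambda)=(b_1-A_1x(\lambda),\,b_2-A_2x(\lambda))^T$, and $\nabla\varphi$ is Lipschitz-continuous w.r.t. $\|\cdot\|_2$ (where $\|\lambda\|_2^2=\|\lambda^{(1)}\|_2^2+\|\lambda^{(2)}\|_2^2$); $L>0$ denotes its Lipschitz constant. Algorithm PDASTM. Input: $L_0>0$ and $\tilde\varepsilon_f,\tilde\varepsilon_{eq},\tilde\varepsilon_{in}>0$. Set $C_0=\alpha_0=0$, $\eta_0=\zeta_0=\lambda_0=0$. For $k=0,1,2,\dots$: set $M_k=L_k/2$ and run the inner loop: repeat (i) set $M_k:=2M_k$ and let $\alpha_{k+1}$ be the largest root of $C_k+\alpha_{k+1}=M_k\alpha_{k+1}^2$, and put $C_{k+1}:=C_k+\alpha_{k+1}$; (ii) $\lambda_{k+1}=(\alpha_{k+1}\zeta_k+C_k\eta_k)/C_{k+1}$; (iii) $\zeta_{k+1}=\arg\min_{\lambda\in\Lambda}\{\frac12\|\lambda-\zeta_k\|_2^2+\alpha_{k+1}(\varphi(\lambda_{k+1})+\langle\nabla\varphi(\lambda_{k+1}),\lambda-\lambda_{k+1}\rangle)\}$;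 (iv) $\eta_{k+1}=(\alpha_{k+1}\zeta_{k+1}+C_k\eta_k)/C_{k+1}$; until $\varphi(\eta_{k+1})\le\varphi(\lambda_{k+1})+\langle\nabla\varphi(\lambda_{k+1}),\eta_{k+1}-\lambda_{k+1}\rangle+\frac{M_k}{2}\|\eta_{k+1}-\lambda_{k+1}\|_2^2$. The values at exit of the inner loop are kept. Then set $\hat x_{k+1}=\frac{1}{C_{k+1}}\sum_{i=0}^{k+1}\alpha_ix(\lambda_i)$, set $L_{k+1}=M_k/2$, and increase $k$ by one. With the increased $k$ (so that $\hat x_k,\eta_k$ are the points just computed), the algorithm stops if $$|f(\hat x_k)+\varphi(\eta_k)|\le\tilde\varepsilon_f,\quad\|A_1\hat x_k-b_1\|_2\le\tilde\varepsilon_{eq},\quad\rho(A_2\hat x_k-b_2,-K)\le\tilde\varepsilon_{in}.$$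
   Formalization: The initial guess is additionally required to satisfy L_0 ≤ 4L; for arbitrary L_0 > 0 the claim is false, since the iteration bounds do not depend on L_0 and a very large L_0 makes the first steps too short. *)

theory Defs
  imports "HOL-Analysis.Analysis"
begin

section \<open>Primal problem\<close>

text \<open>
  The data of \<open>min {f x | x \<in> Q, A\<^sub>1 x = b\<^sub>1, A\<^sub>2 x - b\<^sub>2 \<in> -K}\<close>, in the order
  \<open>f, Q, A\<^sub>1, b\<^sub>1, A\<^sub>2, b\<^sub>2, K\<close>.  Only the values of \<open>objective\<close> on \<open>feas_dom\<close> matter.
  The norm of \<open>E\<close> is the norm of the type \<open>'e\<close>, which need not come from an inner product;
  the Euclidean spaces \<open>'h1\<close>, \<open>'h2\<close> are identified with their duals, so that
  \<open>\<langle>u, v\<rangle>\<close> is \<open>u \<bullet> v\<close>.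
\<close>

record ('e, 'h1, 'h2) conic_problem =
  objective :: "'e \<Rightarrow> real"
  feas_dom :: "'e set"
  A_eq :: "'e \<Rightarrow> 'h1"
  b_eq :: "'h1"
  A_in :: "'e \<Rightarrow> 'h2"
  b_in :: "'h2"
  in_cone :: "'h2 set"

definition finite_dimensional :: "'e::real_vector itself \<Rightarrow> bool" where
  "finite_dimensional _ \<longleftrightarrow> (\<exists>B :: 'e set. finite B \<and> span B = UNIV)"

definition feasible_set :: "('e, 'h1::euclidean_space, 'h2::euclidean_space) conic_problem \<Rightarrow> 'e set" where
  "feasible_set P = {x \<in> feas_dom P. A_eq P x = b_eq P \<and> A_in P x - b_in P \<in> uminus ` in_cone P}"

definition opt_value :: "('e, 'h1::euclidean_space, 'h2::euclidean_space) conic_problem \<Rightarrow> real" where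
  "opt_value P = (INF x \<in> feasible_set P. objective P x)"

text \<open>
  Subgradients are taken for \<open>f\<close> as a function on \<open>Q\<close> (that is, extended by \<open>+\<infinity>\<close> outside
  \<open>Q\<close>).  They are elements of the algebraic dual of \<open>E\<close>, which is the topological dual in finite
  dimension.
\<close>

definition subgradient_on :: "'e::real_vector set \<Rightarrow> ('e \<Rightarrow> real) \<Rightarrow> 'e \<Rightarrow> ('e \<Rightarrow> real) \<Rightarrow> bool" where
  "subgradient_on Q f x g \<longleftrightarrow> linear g \<and> (\<forall>y\<in>Q. f y \<ge> f x + g (y - x))"

definition strongly_convex_on :: "real \<Rightarrow> 'e::real_normed_vector set \<Rightarrow> ('e \<Rightarrow> real) \<Rightarrow> bool" where
  "strongly_convex_on \<gamma> Q f \<longleftrightarrow> \<gamma> > 0 \<and> convex_on Q f \<and>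
     (\<forall>x\<in>Q. \<forall>y\<in>Q. \<forall>g. subgradient_on Q f x g \<longrightarrow>
        f y \<ge> f x + g (y - x) + \<gamma> / 2 * (norm (x - y))\<^sup>2)"

definition dual_cone :: "'h::real_inner set \<Rightarrow> 'h set" where
  "dual_cone K = {l. \<forall>x\<in>K. l \<bullet> x \<ge> 0}"

text \<open>\<open>cone_infeas K v\<close> is \<open>\<rho>(v, -K)\<close>.\<close>

definition cone_infeas :: "'h::euclidean_space set \<Rightarrow> 'h \<Rightarrow> real" where
  "cone_infeas K v = (SUP l \<in> {l \<in> dual_cone K. norm l \<le> 1}. l \<bullet> v)"

section \<open>Dual problem\<close>

definition dual_feas :: "('e, 'h1::euclidean_space, 'h2::euclidean_space) conic_problem \<Rightarrow> ('h1 \<times> 'h2) set" where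
  "dual_feas P = {l. snd l \<in> dual_cone (in_cone P)}"

text \<open>The adjoint maps into the dual of \<open>E\<close>; it is not the library's \<open>adjoint\<close>, which needs
  an inner product on \<open>E\<close>.\<close>

definition dual_adjoint :: "('e \<Rightarrow> 'h::real_inner) \<Rightarrow> 'h \<Rightarrow> ('e \<Rightarrow> real)" where
  "dual_adjoint A u = (\<lambda>x. u \<bullet> A x)"

definition inner_obj :: "('e, 'h1::euclidean_space, 'h2::euclidean_space) conic_problem \<Rightarrow> 'h1 \<times> 'h2 \<Rightarrow> 'e \<Rightarrow> real" where
  "inner_obj P l x =
     - objective P x - (dual_adjoint (A_eq P) (fst l) x + dual_adjoint (A_in P) (snd l) x)"

definition inner_solution :: "('e, 'h1::euclidean_space, 'h2::euclidean_space) conic_problem \<Rightarrow> 'h1 \<times> 'h2 \<Rightarrow> 'e \<Rightarrow> bool" where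
  "inner_solution P l x \<longleftrightarrow> is_arg_max (inner_obj P l) (\<lambda>x. x \<in> feas_dom P) x"

definition x_of :: "('e, 'h1::euclidean_space, 'h2::euclidean_space) conic_problem \<Rightarrow> 'h1 \<times> 'h2 \<Rightarrow> 'e" where
  "x_of P l = (THE x. inner_solution P l x)"

definition dual_fun :: "('e, 'h1::euclidean_space, 'h2::euclidean_space) conic_problem \<Rightarrow> 'h1 \<times> 'h2 \<Rightarrow> real" where
  "dual_fun P l = fst l \<bullet> b_eq P + snd l \<bullet> b_in P + (SUP x \<in> feas_dom P. inner_obj P l x)"

definition dual_solution :: "('e, 'h1::euclidean_space, 'h2::euclidean_space) conic_problem \<Rightarrow> 'h1 \<times> 'h2 \<Rightarrow> bool" where
  "dual_solution P l \<longleftrightarrow> is_arg_max (\<lambda>l. - dual_fun P l) (\<lambda>l. l \<in> dual_feas P) l"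

definition grad :: "('v::real_inner \<Rightarrow> real) \<Rightarrow> 'v \<Rightarrow> 'v" where
  "grad \<phi> l = (THE g. GDERIV \<phi> l :> g)"

section \<open>The adaptive similar triangles method\<close>

text \<open>
  The \<open>k\<close>-th state holds \<open>L\<^sub>k, \<alpha>\<^sub>k, C\<^sub>k, \<lambda>\<^sub>k, \<zeta>\<^sub>k, \<eta>\<^sub>k\<close>.
\<close>

record 'v astm_state =
  L_est :: real
  alpha :: real
  C_sum :: real
  lam :: 'v
  zeta :: 'v
  eta :: 'v

definition astm_init :: "real \<Rightarrow> 'v::real_inner astm_state" where
  "astm_init L0 = \<lparr>L_est = L0, alpha = 0, C_sum = 0, lam = 0, zeta = 0, eta = 0\<rparr>"

text \<open>
  \<open>astm_trial \<phi> \<Lambda> s M t\<close>: one pass through the body of the inner loop, with trial constant \<open>M\<close>,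
  turns the state \<open>s\<close> of index \<open>k\<close> into the candidate \<open>t\<close> for the state of index \<open>k + 1\<close>.
\<close>

definition astm_trial ::
  "('v::real_inner \<Rightarrow> real) \<Rightarrow> 'v set \<Rightarrow> 'v astm_state \<Rightarrow> real \<Rightarrow> 'v astm_state \<Rightarrow> bool" where
  "astm_trial \<phi> \<Lambda> s M t \<longleftrightarrow>
     is_arg_max (\<lambda>a. a) (\<lambda>a. C_sum s + a = M * a\<^sup>2) (alpha t) \<and>
     C_sum t = C_sum s + alpha t \<and>
     lam t = (1 / C_sum t) *\<^sub>R (alpha t *\<^sub>R zeta s + C_sum s *\<^sub>R eta s) \<and>
     is_arg_min
       (\<lambda>l. 1 / 2 * (norm (l - zeta s))\<^sup>2
            + alpha t * (\<phi> (lam t) + grad \<phi> (lam t) \<bullet> (l - lam t)))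
       (\<lambda>l. l \<in> \<Lambda>) (zeta t) \<and>
     eta t = (1 / C_sum t) *\<^sub>R (alpha t *\<^sub>R zeta t + C_sum s *\<^sub>R eta s) \<and>
     L_est t = M / 2"

definition astm_accept :: "('v::real_inner \<Rightarrow> real) \<Rightarrow> real \<Rightarrow> 'v astm_state \<Rightarrow> bool" where
  "astm_accept \<phi> M t \<longleftrightarrow>
     \<phi> (eta t) \<le> \<phi> (lam t) + grad \<phi> (lam t) \<bullet> (eta t - lam t)
                 + M / 2 * (norm (eta t - lam t))\<^sup>2"

text \<open>
  \<open>astm_inner \<phi> \<Lambda> s M t\<close>: the loop ``repeat \<open>M := 2 M\<close>; compute a candidate; until it is
  accepted'', entered with \<open>M\<close>, terminates and leaves the candidate \<open>t\<close>.
\<close>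

inductive astm_inner ::
  "('v::real_inner \<Rightarrow> real) \<Rightarrow> 'v set \<Rightarrow> 'v astm_state \<Rightarrow> real \<Rightarrow> 'v astm_state \<Rightarrow> bool"
  for \<phi> :: "'v::real_inner \<Rightarrow> real" and \<Lambda> :: "'v set" and s :: "'v astm_state"
where
  exit: "astm_trial \<phi> \<Lambda> s (2 * M) t \<Longrightarrow> astm_accept \<phi> (2 * M) t \<Longrightarrow> astm_inner \<phi> \<Lambda> s M t"
| again: "astm_trial \<phi> \<Lambda> s (2 * M) u \<Longrightarrow> \<not> astm_accept \<phi> (2 * M) u \<Longrightarrow>
          astm_inner \<phi> \<Lambda> s (2 * M) t \<Longrightarrow> astm_inner \<phi> \<Lambda> s M t"

text \<open>The iterations, run without the outer stopping test.\<close>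

definition pdastm_run ::
  "('e, 'h1::euclidean_space, 'h2::euclidean_space) conic_problem \<Rightarrow> real
    \<Rightarrow> (nat \<Rightarrow> ('h1 \<times> 'h2) astm_state) \<Rightarrow> bool" where
  "pdastm_run P L0 s \<longleftrightarrow>
     s 0 = astm_init L0 \<and>
     (\<forall>k. astm_inner (dual_fun P) (dual_feas P) (s k) (L_est (s k) / 2) (s (Suc k)))"

definition x_hat ::
  "('e::real_vector, 'h1::euclidean_space, 'h2::euclidean_space) conic_problem
    \<Rightarrow> (nat \<Rightarrow> ('h1 \<times> 'h2) astm_state) \<Rightarrow> nat \<Rightarrow> 'e" where
  "x_hat P s k = (1 / C_sum (s k)) *\<^sub>R (\<Sum>i\<le>k. alpha (s i) *\<^sub>R x_of P (lam (s i)))"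

definition pdastm_stop ::
  "('e::real_vector, 'h1::euclidean_space, 'h2::euclidean_space) conic_problem
    \<Rightarrow> real \<Rightarrow> real \<Rightarrow> real \<Rightarrow> (nat \<Rightarrow> ('h1 \<times> 'h2) astm_state) \<Rightarrow> nat \<Rightarrow> bool" where
  "pdastm_stop P \<epsilon>f \<epsilon>eq \<epsilon>in s k \<longleftrightarrow>
     \<bar>objective P (x_hat P s k) + dual_fun P (eta (s k))\<bar> \<le> \<epsilon>f \<and>
     norm (A_eq P (x_hat P s k) - b_eq P) \<le> \<epsilon>eq \<and>
     cone_infeas (in_cone P) (A_in P (x_hat P s k) - b_in P) \<le> \<epsilon>in"

definition eps_solution ::
  "('e, 'h1::euclidean_space, 'h2::euclidean_space) conic_problem
    \<Rightarrow> real \<Rightarrow> real \<Rightarrow> real \<Rightarrow> 'e \<Rightarrow> bool" where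
  "eps_solution P \<epsilon>f \<epsilon>eq \<epsilon>in x \<longleftrightarrow>
     \<bar>objective P x - opt_value P\<bar> \<le> \<epsilon>f \<and>
     norm (A_eq P x - b_eq P) \<le> \<epsilon>eq \<and>
     cone_infeas (in_cone P) (A_in P x - b_in P) \<le> \<epsilon>in"

end

(* The dual function phi is the supremum over x in Q of l . r(x) - f(x), where r(x) = b - A x.
   Optimality of x(l) makes -A^T l a subgradient of f at x(l), so strong convexity gives quadratic
   growth there; as A is bounded in finite dimension, phi is differentiable with gradient r(x(l)).

   The similar triangles method satisfies, for every l in Lambda,
     C_k phi(eta_k) <= sum_i alpha_i (phi(lambda_i) + <grad phi(lambda_i), l - lambda_i>) + |l|^2 / 2,
   and M_k <= 2L forces C_k >= k^2 / (8L); only M_0 can be as large as 4L, which the first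
   step absorbs because C_0 = 0.  By Jensen's inequality the right-hand side is at most
   C_k (l . r(xhat_k) - f(xhat_k)) + |l|^2 / 2.  Choosing l with blocks of norm at most 2 R_1 and 2 R_2
   gives, with a = |A_1 xhat - b_1| and rho the cone infeasibility,
     f(xhat) + phi(eta) + 2 R_1 a + 2 R_2 rho <= 16 L (R_1^2 + R_2^2) / k^2,
   while lstar yields f(xhat) + phi(eta) >= f(xhat) + phi(lstar) >= - R_1 a - R_2 rho.
   Together these bound all three residuals.  First-order optimality of lstar shows that
   x(lstar) is primal optimal, so Opt[P_1] = - phi(lstar). *)

theory Submission
  imports Defs
begin

section \<open>Finite-dimensional normed spaces\<close>

text \<open>Dividing by \<open>c\<close> keeps \<open>y\<close> in \<open>V\<close>, so the norm
  controls the coefficient along a direction outside \<open>V\<close>.\<close>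

lemma norm_ge_infdist_subspace:
  fixes a y :: "'a::real_normed_vector"
  assumes "subspace V" "y \<in> V"
  shows "\<bar>c\<bar> * infdist a V \<le> norm (c *\<^sub>R a + y)"
proof (cases "c = 0")
  case False
  have "- (1 / c) *\<^sub>R y \<in> V"
    using assms by (intro subspace_scale)
  then have "infdist a V \<le> norm (a + (1 / c) *\<^sub>R y)"
    using infdist_le[of "- (1 / c) *\<^sub>R y" V a] by (simp add: dist_norm)
  then have "\<bar>c\<bar> * infdist a V \<le> norm (c *\<^sub>R (a + (1 / c) *\<^sub>R y))"
    by (simp add: mult_left_mono)
  with False show ?thesis
    by (simp add: scaleR_add_right)
qed simp

text \<open>The norm is arbitrary, so spanning vectors are added one at a time: the coefficients
  along the new vector and the remainders in the smaller span are both Cauchy.\<close>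

lemma complete_span_finite:
  fixes S :: "'a::real_normed_vector set"
  assumes "finite S"
  shows "complete (span S)"
  using assms
proof (induction S)
  case empty
  then show ?case by (simp add: compact_imp_complete)
next
  case (insert a S)
  show ?case
  proof (cases "a \<in> span S")
    case True
    then show ?thesis using insert by (simp add: span_redundant)
  next
    case False
    define d where "d = infdist a (span S)"
    \<comment> \<open>A complete subspace is closed, so a vector outside it has positive distance
      from it.\<close>
    have "d > 0"
      unfolding d_def using False complete_imp_closed[OF insert.IH] span_zero[of S]
      by (metis empty_iff infdist_pos_not_in_closed)
    show ?thesis
    proof (rule completeI)
      fix u assume u: "\<forall>n. u n \<in> span (insert a S)" "Cauchy u"
      then obtain c where c: "\<And>n. u n - c n *\<^sub>R a \<in> span S"
        unfolding span_breakdown_eq by metis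
      define y where "y n = u n - c n *\<^sub>R a" for n
      have uy: "u n = c n *\<^sub>R a + y n" for n
        by (simp add: y_def)
      have bound: "\<bar>c m - c n\<bar> * d \<le> norm (u m - u n)" for m n
      proof -
        have "y m - y n \<in> span S"
          unfolding y_def by (intro span_diff c)
        moreover have "(c m - c n) *\<^sub>R a + (y m - y n) = u m - u n"
          by (simp add: y_def algebra_simps)
        ultimately show ?thesis
          using norm_ge_infdist_subspace[OF subspace_span, of "y m - y n" S "c m - c n" a]
          by (simp add: d_def)
      qed
      have "Cauchy c"
      proof (rule CauchyI)
        fix e :: real assume "e > 0"
        then obtain N where N: "\<forall>m\<ge>N. \<forall>n\<ge>N. norm (u m - u n) < e * d"
          using CauchyD[OF u(2), of "e * d"] \<open>d > 0\<close> by auto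
        have "\<bar>c m - c n\<bar> < e" if "m \<ge> N" "n \<ge> N" for m n
          using bound[of m n] N that \<open>d > 0\<close>
          by (meson le_less_trans mult_less_cancel_right_pos)
        then show "\<exists>N. \<forall>m\<ge>N. \<forall>n\<ge>N. norm (c m - c n) < e"
          by auto
      qed
      then obtain c0 where c0: "c \<longlonglongrightarrow> c0"
        using Cauchy_convergent_iff convergent_def by blast
      then have ca: "(\<lambda>n. c n *\<^sub>R a) \<longlonglongrightarrow> c0 *\<^sub>R a"
        by (intro tendsto_intros)
      have "Cauchy y"
      proof (rule CauchyI)
        fix e :: real assume "e > 0"
        then obtain M N
          where "\<forall>m\<ge>M. \<forall>n\<ge>M. norm (u m - u n) < e / 2"
            and "\<forall>m\<ge>N. \<forall>n\<ge>N. norm (c m *\<^sub>R a - c n *\<^sub>R a) < e / 2"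
          using CauchyD[OF u(2), of "e / 2"] CauchyD[OF LIMSEQ_imp_Cauchy[OF ca], of "e / 2"] by auto
        then have "norm (y m - y n) < e" if "m \<ge> max M N" "n \<ge> max M N" for m n
          using norm_triangle_ineq4[of "u m - u n" "c m *\<^sub>R a - c n *\<^sub>R a"] that
          by (fastforce simp: y_def algebra_simps)
        then show "\<exists>N. \<forall>m\<ge>N. \<forall>n\<ge>N. norm (y m - y n) < e"
          by blast
      qed
      then obtain y0 where y0: "y0 \<in> span S" "y \<longlonglongrightarrow> y0"
        using completeE[OF insert.IH, of y] c by (auto simp: y_def)
      have "u \<longlonglongrightarrow> c0 *\<^sub>R a + y0"
        unfolding uy[abs_def] by (intro tendsto_add ca y0)
      moreover have "c0 *\<^sub>R a + y0 \<in> span (insert a S)"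
        using y0 by (auto simp: span_breakdown_eq intro!: exI[of _ c0])
      ultimately show "\<exists>l\<in>span (insert a S). u \<longlonglongrightarrow> l"
        by blast
    qed
  qed
qed

text \<open>Same splitting as for completeness: the coefficient along the new vector is at most
  \<open>norm x / d\<close>, and the remainder falls under the induction hypothesis.\<close>

lemma linear_bounded_on_span_finite:
  fixes S :: "'a::real_normed_vector set" and g :: "'a \<Rightarrow> 'b::real_normed_vector"
  assumes "finite S" "linear g"
  shows "\<exists>B. \<forall>x\<in>span S. norm (g x) \<le> B * norm x"
  using assms(1)
proof (induction S)
  case empty
  then show ?case using linear_0[OF assms(2)] by simp
next
  case (insert a S)
  then obtain B where B: "\<And>x. x \<in> span S \<Longrightarrow> norm (g x) \<le> B * norm x"
    by blast
  \<comment> \<open>On a trivial span \<open>B\<close> may be negative; monotonicity below requires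
    a nonnegative constant.\<close>
  define B' where "B' = max B 0"
  have B': "norm (g x) \<le> B' * norm x" if "x \<in> span S" for x
    using order_trans[OF B[OF that] mult_right_mono[of B B' "norm x"]] by (simp add: B'_def)
  have [simp]: "B' \<ge> 0" by (simp add: B'_def)
  show ?case
  proof (cases "a \<in> span S")
    case True
    then show ?thesis using insert by (simp add: span_redundant)
  next
    case False
    define d where "d = infdist a (span S)"
    have "d > 0"
      unfolding d_def
      using False complete_imp_closed[OF complete_span_finite[OF insert.hyps(1)]] span_zero[of S]
      by (metis empty_iff infdist_pos_not_in_closed)
    have "norm (g x) \<le> (norm (g a) / d + B' * (1 + norm a / d)) * norm x"
      if x: "x \<in> span (insert a S)" for x
    proof -
      obtain c where c: "x - c *\<^sub>R a \<in> span S"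
        using x unfolding span_breakdown_eq by blast
      define y where "y = x - c *\<^sub>R a"
      have "\<bar>c\<bar> * d \<le> norm x"
        using norm_ge_infdist_subspace[OF subspace_span c, of c a] by (simp add: d_def)
      then have cb: "\<bar>c\<bar> \<le> norm x / d"
        using \<open>d > 0\<close> by (simp add: field_simps)
      have "norm (g x) = norm (c *\<^sub>R g a + g y)"
        using assms(2) by (simp add: y_def linear_diff linear_scale)
      also have "\<dots> \<le> \<bar>c\<bar> * norm (g a) + B' * norm y"
        using B'[of y] c by (intro norm_triangle_le) (simp add: y_def)
      also have "\<dots> \<le> norm x / d * norm (g a) + B' * (norm x + norm x / d * norm a)"
      proof -
        have "norm y \<le> norm x + \<bar>c\<bar> * norm a"
          unfolding y_def by (metis norm_scaleR norm_triangle_ineq4)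
        also have "\<dots> \<le> norm x + norm x / d * norm a"
          using mult_right_mono[OF cb, of "norm a"] by simp
        finally show ?thesis
          using cb by (intro add_mono mult_right_mono mult_left_mono) auto
      qed
      also have "\<dots> = (norm (g a) / d + B' * (1 + norm a / d)) * norm x"
        by (simp add: algebra_simps)
      finally show ?thesis .
    qed
    then show ?thesis by blast
  qed
qed

lemma finite_dimensional_linear_imp_bounded_linear:
  fixes g :: "'a::real_normed_vector \<Rightarrow> 'b::real_normed_vector"
  assumes "finite_dimensional TYPE('a)" "linear g"
  shows "bounded_linear g"
proof -
  obtain S :: "'a set" where "finite S" "span S = UNIV"
    using assms(1) unfolding finite_dimensional_def by blast
  then obtain B where "\<And>x. norm (g x) \<le> B * norm x"
    using linear_bounded_on_span_finite[OF \<open>finite S\<close> assms(2)] by auto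
  then show ?thesis
    using assms(2)
    by (intro bounded_linear_intro[where K = B]) (simp_all add: linear_add linear_scale mult.commute)
qed

section \<open>Smooth convex functions and proximal steps\<close>

lemma gderiv_unique: "GDERIV f x :> d \<Longrightarrow> GDERIV f x :> d' \<Longrightarrow> d = d'"
proof -
  assume "GDERIV f x :> d" "GDERIV f x :> d'"
  then have "(\<lambda>h. h \<bullet> d) = (\<lambda>h. h \<bullet> d')"
    unfolding gderiv_def by (rule has_derivative_unique)
  then show "d = d'"
    using vector_eq_ldot by metis
qed

lemma grad_eq: "GDERIV f x :> d \<Longrightarrow> grad f x = d"
  unfolding grad_def by (rule the_equality) (auto intro: gderiv_unique)

text \<open>The remainder lies between 0 and a multiple of the squared distance, hence is of smaller
  order than the distance.\<close>

lemma GDERIV_I_quadratic: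
  fixes f :: "'v::real_inner \<Rightarrow> real"
  assumes lower: "\<And>y. f y \<ge> f x + g \<bullet> (y - x)"
    and upper: "\<And>y. f y \<le> f x + g \<bullet> (y - x) + c * (norm (y - x))\<^sup>2"
  shows "GDERIV f x :> g"
  unfolding gderiv_def
proof (rule has_derivativeI_sandwich[of 1])
  show "bounded_linear (\<lambda>h. h \<bullet> g)"
    by (rule bounded_linear_inner_left)
  fix y assume "y \<noteq> x"
  have "0 \<le> f y - f x - (y - x) \<bullet> g" "f y - f x - (y - x) \<bullet> g \<le> c * (norm (y - x))\<^sup>2"
    using lower[of y] upper[of y] by (simp_all add: inner_commute algebra_simps)
  then show "norm (f y - f x - (y - x) \<bullet> g) / norm (y - x) \<le> c * norm (y - x)"
    using \<open>y \<noteq> x\<close> by (simp add: field_simps power2_eq_square)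
next
  have "((\<lambda>y. c * norm (y - x)) \<longlongrightarrow> c * norm (x - x)) (at x)"
    by (intro tendsto_intros)
  then show "((\<lambda>y. c * norm (y - x)) \<longlongrightarrow> 0) (at x)"
    by simp
qed simp

text \<open>Along the segment from \<open>x\<close> to \<open>y\<close>, the gap \<open>h\<close>
  between \<open>f\<close> and its quadratic model has nonpositive derivative; the claim is
  \<open>h 1 <= h 0\<close>.\<close>

lemma descent_lemma:
  fixes f :: "'v::real_inner \<Rightarrow> real"
  assumes deriv: "\<And>x. GDERIV f x :> g x" and lip: "L-lipschitz_on UNIV g"
  shows "f y \<le> f x + g x \<bullet> (y - x) + L / 2 * (norm (y - x))\<^sup>2"
proof -
  define d where "d = y - x"
  define h where "h t = f (x + t *\<^sub>R d) - t * (g x \<bullet> d) - L / 2 * t\<^sup>2 * (norm d)\<^sup>2" for t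
  have "h 0 \<ge> h 1"
  proof (rule DERIV_nonpos_imp_nonincreasing[of 0 1 h])
    fix t :: real assume t: "0 \<le> t" "t \<le> 1"
    have "((\<lambda>t. f (x + t *\<^sub>R d)) has_derivative (\<lambda>s. (s *\<^sub>R d) \<bullet> g (x + t *\<^sub>R d))) (at t)"
      using deriv[of "x + t *\<^sub>R d"] unfolding gderiv_def
      by (rule has_derivative_compose[rotated]) (auto intro!: derivative_eq_intros)
    then have "DERIV (\<lambda>t. f (x + t *\<^sub>R d)) t :> g (x + t *\<^sub>R d) \<bullet> d"
      by (rule has_derivative_imp_has_field_derivative) (simp add: inner_commute mult.commute)
    then have D: "DERIV h t :> (g (x + t *\<^sub>R d) - g x) \<bullet> d - L * t * (norm d)\<^sup>2"
      unfolding h_def by (auto intro!: derivative_eq_intros simp: inner_diff_left)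
    have "(g (x + t *\<^sub>R d) - g x) \<bullet> d \<le> norm (g (x + t *\<^sub>R d) - g x) * norm d"
      by (rule norm_cauchy_schwarz)
    also have "\<dots> \<le> (L * norm (t *\<^sub>R d)) * norm d"
      using lipschitz_onD[OF lip, of "x + t *\<^sub>R d" x]
      by (intro mult_right_mono) (simp_all add: dist_norm)
    finally have "(g (x + t *\<^sub>R d) - g x) \<bullet> d \<le> L * t * (norm d)\<^sup>2"
      using t by (simp add: power2_eq_square)
    with D show "\<exists>y. DERIV h t :> y \<and> y \<le> 0"
      by fastforce
  qed simp
  then show ?thesis
    by (simp add: h_def d_def)
qed

text \<open>Thus the proximal step is the Euclidean projection of the gradient step
  \<open>z - a *\<^sub>R g\<close>.\<close>

lemma prox_complete_square:
  fixes l z g m :: "'v::real_inner"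
  shows "1 / 2 * (norm (l - z))\<^sup>2 + a * (c + g \<bullet> (l - m))
    = 1 / 2 * (dist (z - a *\<^sub>R g) l)\<^sup>2 + (a * c + a * (g \<bullet> (z - m)) - a\<^sup>2 / 2 * (g \<bullet> g))"
proof -
  define w v where "w = l - z" and "v = z - m"
  have eqs: "z - a *\<^sub>R g - l = - (w + a *\<^sub>R g)" "l - m = w + v"
    by (simp_all add: w_def v_def)
  show ?thesis
    unfolding dist_norm eqs norm_minus_cancel w_def[symmetric] v_def[symmetric]
    by (simp add: power2_norm_eq_inner inner_add_left inner_add_right inner_commute[of w g]
        power2_eq_square[of a] field_simps)
qed

lemma prox_exists:
  fixes z :: "'v::euclidean_space"
  assumes "closed S" "S \<noteq> {}"
  shows "\<exists>p. is_arg_min (\<lambda>l. 1 / 2 * (norm (l - z))\<^sup>2 + a * (c + g \<bullet> (l - m))) (\<lambda>l. l \<in> S) p"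
  using closest_point_exists[OF assms, of "z - a *\<^sub>R g"]
  unfolding is_arg_min_linorder prox_complete_square
  by (intro exI[of _ "closest_point S (z - a *\<^sub>R g)"]) (auto intro!: power_mono)

text \<open>This is the variational inequality of that projection, expanded into squared
  norms.\<close>

lemma prox_three_point:
  fixes z :: "'v::euclidean_space"
  assumes "closed S" "convex S"
    and "is_arg_min (\<lambda>l. 1 / 2 * (norm (l - z))\<^sup>2 + a * (c + g \<bullet> (l - m))) (\<lambda>l. l \<in> S) p"
    and "l \<in> S"
  shows "a * (g \<bullet> (p - m)) + 1 / 2 * (norm (p - z))\<^sup>2
    \<le> a * (g \<bullet> (l - m)) + 1 / 2 * (norm (l - z))\<^sup>2 - 1 / 2 * (norm (l - p))\<^sup>2"
proof -
  have "p \<in> S" "\<forall>y\<in>S. dist (z - a *\<^sub>R g) p \<le> dist (z - a *\<^sub>R g) y"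
    using assms(3) unfolding is_arg_min_linorder prox_complete_square
    by (auto intro: power2_le_imp_le)
  then have "(z - a *\<^sub>R g - p) \<bullet> (l - p) \<le> 0"
    using assms by (intro any_closest_point_dot[of S])
  then show ?thesis
    by (simp add: power2_norm_eq_inner algebra_simps inner_commute)
qed

section \<open>The adaptive similar triangles method\<close>

lemma largest_root_exists:
  fixes M C :: real
  assumes "M > 0" "C \<ge> 0"
  shows "\<exists>a>0. is_arg_max (\<lambda>a. a) (\<lambda>a. C + a = M * a\<^sup>2) a"
proof -
  define D where "D = sqrt (1 + 4 * M * C)"
  have D: "D\<^sup>2 = 1 + 4 * M * C" "D \<ge> 0"
    using assms by (simp_all add: D_def)
  \<comment> \<open>The larger root by the quadratic formula: every root \<open>x\<close> satisfies
    \<open>(2 * M * x - 1)\<^sup>2 = D\<^sup>2\<close>.\<close>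
  define a where "a = (1 + D) / (2 * M)"
  have "2 * M * a = 1 + D"
    using assms by (simp add: a_def)
  then have "(2 * M * a - 1)\<^sup>2 = 1 + 4 * M * C"
    using D by simp
  then have "4 * M * (M * a\<^sup>2 - a - C) = 0"
    by (simp add: power2_eq_square algebra_simps)
  then have "C + a = M * a\<^sup>2"
    using assms by simp
  moreover have "x \<le> a" if "C + x = M * x\<^sup>2" for x
  proof -
    have "(2 * M * x - 1)\<^sup>2 = 4 * M * (M * x\<^sup>2 - x) + 1"
      by (simp add: power2_eq_square algebra_simps)
    also have "\<dots> = D\<^sup>2"
      using that D by (simp add: algebra_simps flip: that)
    finally have "2 * M * x - 1 \<le> D"
      using D(2) by (metis abs_le_square_iff abs_of_nonneg abs_ge_self order.trans order_refl)
    then show ?thesis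
      using assms by (simp add: a_def field_simps)
  qed
  moreover have "a > 0"
    using assms D by (simp add: a_def)
  ultimately show ?thesis
    unfolding is_arg_max_linorder by blast
qed

lemma largest_root_pos:
  fixes M C :: real
  assumes "M > 0" "C \<ge> 0" "is_arg_max (\<lambda>a. a) (\<lambda>a. C + a = M * a\<^sup>2) a"
  shows "a > 0"
  using largest_root_exists[OF assms(1,2)] assms(3) unfolding is_arg_max_linorder by force

text \<open>What the method uses of the dual problem: convexity enters through
  \<open>gradient_ineq\<close>, and \<open>zero_mem\<close> makes the starting point
  feasible.\<close>

locale similar_triangles =
  fixes \<phi> :: "'v::euclidean_space \<Rightarrow> real" and \<Lambda> :: "'v set" and L :: real
  assumes deriv: "GDERIV \<phi> x :> grad \<phi> x"
    and gradient_ineq: "\<phi> x + grad \<phi> x \<bullet> (y - x) \<le> \<phi> y"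
    and lipschitz: "L-lipschitz_on UNIV (grad \<phi>)"
    and L_pos: "L > 0"
    and closed: "closed \<Lambda>" and convex: "convex \<Lambda>" and zero_mem: "0 \<in> \<Lambda>"
begin

section \<open>State invariant and termination of the inner loop\<close>

definition valid_state :: "'v astm_state \<Rightarrow> bool" where
  "valid_state s \<longleftrightarrow> C_sum s \<ge> 0 \<and> zeta s \<in> \<Lambda> \<and> eta s \<in> \<Lambda>"

lemma valid_init: "valid_state (astm_init L0)"
  by (simp add: valid_state_def astm_init_def zero_mem)

lemma trial_exists:
  assumes "valid_state s" "M > 0"
  shows "\<exists>t. astm_trial \<phi> \<Lambda> s M t"
proof -
  obtain a where a: "is_arg_max (\<lambda>a. a) (\<lambda>a. C_sum s + a = M * a\<^sup>2) a"
    using largest_root_exists assms unfolding valid_state_def by blast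
  define C where "C = C_sum s + a"
  define m where "m = (1 / C) *\<^sub>R (a *\<^sub>R zeta s + C_sum s *\<^sub>R eta s)"
  have "\<Lambda> \<noteq> {}"
    using zero_mem by blast
  then obtain z where z: "is_arg_min
      (\<lambda>l. 1 / 2 * (norm (l - zeta s))\<^sup>2 + a * (\<phi> m + grad \<phi> m \<bullet> (l - m))) (\<lambda>l. l \<in> \<Lambda>) z"
    using prox_exists[OF closed] by blast
  show ?thesis
    by (rule exI[of _ "\<lparr>L_est = M / 2, alpha = a, C_sum = C, lam = m, zeta = z,
          eta = (1 / C) *\<^sub>R (a *\<^sub>R z + C_sum s *\<^sub>R eta s)\<rparr>"])
      (use a z in \<open>simp add: astm_trial_def C_def m_def\<close>)
qed

lemma trial_C_sum:
  assumes "valid_state s" "M > 0" "astm_trial \<phi> \<Lambda> s M t"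
  shows "alpha t > 0" "C_sum t > 0" "C_sum t = C_sum s + alpha t" "C_sum t = M * (alpha t)\<^sup>2"
proof -
  show "alpha t > 0"
    using assms largest_root_pos unfolding valid_state_def astm_trial_def by blast
  then show "C_sum t > 0" "C_sum t = C_sum s + alpha t" "C_sum t = M * (alpha t)\<^sup>2"
    using assms unfolding valid_state_def astm_trial_def is_arg_max_linorder by auto
qed

text \<open>\<open>eta t\<close> is a convex combination of \<open>zeta t\<close> and
  \<open>eta s\<close>.\<close>

lemma trial_valid:
  assumes "valid_state s" "M > 0" "astm_trial \<phi> \<Lambda> s M t"
  shows "valid_state t"
proof -
  note C = trial_C_sum[OF assms]
  have z: "zeta t \<in> \<Lambda>" and
    "eta t = (alpha t / C_sum t) *\<^sub>R zeta t + (C_sum s / C_sum t) *\<^sub>R eta s"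
    using assms(3) unfolding astm_trial_def is_arg_min_linorder
    by (auto simp: scaleR_add_right)
  moreover have "alpha t / C_sum t + C_sum s / C_sum t = 1"
    using C(2,3) by (simp add: add.commute flip: add_divide_distrib)
  ultimately have "eta t \<in> \<Lambda>"
    using convexD[OF convex z, of "eta s" "alpha t / C_sum t" "C_sum s / C_sum t"] assms(1) C
    by (simp add: valid_state_def)
  with z C show ?thesis
    by (simp add: valid_state_def)
qed

text \<open>The acceptance test is the descent lemma with \<open>M\<close> for \<open>L\<close>, so
  doubling ends once \<open>M\<close> reaches \<open>L\<close>.\<close>

lemma trial_accepted:
  assumes "L \<le> M"
  shows "astm_accept \<phi> M t"
proof -
  have "L / 2 * (norm (eta t - lam t))\<^sup>2 \<le> M / 2 * (norm (eta t - lam t))\<^sup>2"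
    using assms by (intro mult_right_mono) auto
  then show ?thesis
    using descent_lemma[OF deriv lipschitz, of "eta t" "lam t"] by (simp add: astm_accept_def)
qed

lemma inner_exists:
  assumes "valid_state s" "M > 0"
  shows "\<exists>t. astm_inner \<phi> \<Lambda> s M t"
proof -
  \<comment> \<open>\<open>n\<close> bounds the number of rejected trials; a loop entered with
    \<open>M\<close> tests \<open>2 * M\<close> first.\<close>
  obtain n where "L / (2 * M) < 2 ^ n"
    using real_arch_pow[of 2 "L / (2 * M)"] by auto
  then have "L \<le> 2 * M * 2 ^ n"
    using assms by (simp add: field_simps)
  then show ?thesis
    using assms(2)
  proof (induction n arbitrary: M)
    case 0
    then show ?case
      using trial_exists[OF assms(1), of "2 * M"] trial_accepted[of "2 * M"]
      by (auto intro: astm_inner.exit)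
  next
    case (Suc n)
    obtain u where u: "astm_trial \<phi> \<Lambda> s (2 * M) u"
      using trial_exists[OF assms(1), of "2 * M"] Suc.prems by auto
    obtain t where "astm_inner \<phi> \<Lambda> s (2 * M) t"
      using Suc.IH[of "2 * M"] Suc.prems by auto
    with u show ?case
      by (meson astm_inner.intros)
  qed
qed

text \<open>After a rejection, the last rejected constant is below \<open>L\<close>, so the accepted
  one, its double, is at most \<open>2 * L\<close>.\<close>

lemma inner_result:
  assumes "astm_inner \<phi> \<Lambda> s M t" "M > 0"
  shows "\<exists>M'>0. astm_trial \<phi> \<Lambda> s M' t \<and> astm_accept \<phi> M' t \<and> (M' = 2 * M \<or> M' \<le> 2 * L)"
  using assms
proof (induction rule: astm_inner.induct)
  case (exit M t)
  then show ?case
    by (intro exI[of _ "2 * M"]) auto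
next
  case (again M u t)
  then have "2 * M < L"
    using trial_accepted[of "2 * M" u] by fastforce
  with again show ?case
    by fastforce
qed

text \<open>Since \<open>C\<^sub>k\<^sub>+\<^sub>1 = M\<^sub>k \<alpha>\<^sub>k\<^sub>+\<^sub>1\<^sup>2\<close> and the triangles \<open>\<lambda>\<^sub>k\<^sub>+\<^sub>1, \<eta>\<^sub>k\<^sub>+\<^sub>1, \<eta>\<^sub>k\<close> and
  \<open>\<zeta>\<^sub>k, \<zeta>\<^sub>k\<^sub>+\<^sub>1, \<eta>\<^sub>k\<close> are similar with ratio \<open>\<alpha>\<^sub>k\<^sub>+\<^sub>1 / C\<^sub>k\<^sub>+\<^sub>1\<close>, the quadratic term of the acceptance
  test becomes \<open>\<parallel>\<zeta>\<^sub>k\<^sub>+\<^sub>1 - \<zeta>\<^sub>k\<parallel>\<^sup>2 / 2\<close>, which the proximal step pays for.\<close>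

lemma step_estimate:
  assumes "valid_state s" "M > 0" "astm_trial \<phi> \<Lambda> s M t" "astm_accept \<phi> M t" "l \<in> \<Lambda>"
  shows "C_sum t * \<phi> (eta t) + 1 / 2 * (norm (l - zeta t))\<^sup>2
    \<le> C_sum s * \<phi> (eta s) + 1 / 2 * (norm (l - zeta s))\<^sup>2
      + alpha t * (\<phi> (lam t) + grad \<phi> (lam t) \<bullet> (l - lam t))"
proof -
  note C = trial_C_sum[OF assms(1-3)]
  define g where "g = grad \<phi> (lam t)"
  have eta: "C_sum t *\<^sub>R eta t = alpha t *\<^sub>R zeta t + C_sum s *\<^sub>R eta s"
    and lam: "C_sum t *\<^sub>R lam t = alpha t *\<^sub>R zeta s + C_sum s *\<^sub>R eta s"
    and prox: "is_arg_min
       (\<lambda>l. 1 / 2 * (norm (l - zeta s))\<^sup>2 + alpha t * (\<phi> (lam t) + g \<bullet> (l - lam t)))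
       (\<lambda>l. l \<in> \<Lambda>) (zeta t)"
    using assms(3) C(2) by (auto simp: astm_trial_def g_def)
  have "C_sum t *\<^sub>R (eta t - lam t) = alpha t *\<^sub>R (zeta t - zeta s)"
    unfolding scaleR_diff_right eta lam by simp
  then have "(norm (C_sum t *\<^sub>R (eta t - lam t)))\<^sup>2 = (norm (alpha t *\<^sub>R (zeta t - zeta s)))\<^sup>2"
    by simp
  then have "(C_sum t)\<^sup>2 * (norm (eta t - lam t))\<^sup>2 = (alpha t)\<^sup>2 * (norm (zeta t - zeta s))\<^sup>2"
    by (simp add: power_mult_distrib)
  then have "M * ((C_sum t)\<^sup>2 * (norm (eta t - lam t))\<^sup>2)
      = C_sum t * (norm (zeta t - zeta s))\<^sup>2"
    by (simp add: C(4))
  then have quad: "C_sum t * (M / 2 * (norm (eta t - lam t))\<^sup>2) = 1 / 2 * (norm (zeta t - zeta s))\<^sup>2"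
    using C(2) by (simp add: power2_eq_square mult.left_commute[of M])
  \<comment> \<open>The definition of \<open>eta t\<close> splits the linear term: the part at
    \<open>zeta t\<close> goes to the proximal step, the part at \<open>eta s\<close> to the
    gradient inequality.\<close>
  have "C_sum t * (g \<bullet> (eta t - lam t)) = g \<bullet> (C_sum t *\<^sub>R eta t - C_sum t *\<^sub>R lam t)"
    by (simp add: algebra_simps)
  also have "\<dots> = g \<bullet> (alpha t *\<^sub>R zeta t + C_sum s *\<^sub>R eta s - (alpha t + C_sum s) *\<^sub>R lam t)"
    unfolding eta by (simp add: C(3) add.commute)
  also have "\<dots> = alpha t * (g \<bullet> (zeta t - lam t)) + C_sum s * (g \<bullet> (eta s - lam t))"
    by (simp add: algebra_simps)
  finally have lin: "C_sum t * (g \<bullet> (eta t - lam t))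
    = alpha t * (g \<bullet> (zeta t - lam t)) + C_sum s * (g \<bullet> (eta s - lam t))" .
  have "C_sum t * \<phi> (eta t) \<le> C_sum t *
      (\<phi> (lam t) + g \<bullet> (eta t - lam t) + M / 2 * (norm (eta t - lam t))\<^sup>2)"
    using assms(4) C(2) unfolding astm_accept_def g_def by (intro mult_left_mono) auto
  also have "\<dots> = C_sum s * (\<phi> (lam t) + g \<bullet> (eta s - lam t)) + alpha t * \<phi> (lam t)
      + (alpha t * (g \<bullet> (zeta t - lam t)) + 1 / 2 * (norm (zeta t - zeta s))\<^sup>2)"
    unfolding distrib_left lin quad by (simp add: C(3) algebra_simps)
  also have "C_sum s * (\<phi> (lam t) + g \<bullet> (eta s - lam t)) \<le> C_sum s * \<phi> (eta s)"
    using assms(1) gradient_ineq unfolding valid_state_def g_def by (intro mult_left_mono) auto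
  also note prox_three_point[OF closed convex prox assms(5)]
  finally show ?thesis
    by (simp add: g_def distrib_left)
qed

text \<open>\<open>pdastm_run\<close> for general \<open>\<phi>\<close> and
  \<open>\<Lambda>\<close>; both unfold to the same formula in the dual instance.\<close>

definition is_run :: "real \<Rightarrow> (nat \<Rightarrow> 'v astm_state) \<Rightarrow> bool" where
  "is_run L0 s \<longleftrightarrow> s 0 = astm_init L0 \<and> (\<forall>k. astm_inner \<phi> \<Lambda> (s k) (L_est (s k) / 2) (s (Suc k)))"

text \<open>Entry halves \<open>L_est s\<close> and the first pass doubles it back, so the first
  trial constant is \<open>L_est s\<close> itself.\<close>

lemma inner_step:
  assumes "astm_inner \<phi> \<Lambda> s (L_est s / 2) t" "L_est s > 0"
  obtains M where "M > 0" "astm_trial \<phi> \<Lambda> s M t" "astm_accept \<phi> M t"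
    "M \<le> max (L_est s) (2 * L)" "L_est t = M / 2"
proof -
  obtain M where M: "M > 0" "astm_trial \<phi> \<Lambda> s M t" "astm_accept \<phi> M t"
      "M = 2 * (L_est s / 2) \<or> M \<le> 2 * L"
    using inner_result[OF assms(1)] assms(2) by (auto simp: less_divide_eq)
  moreover have "L_est t = M / 2"
    using M unfolding astm_trial_def by blast
  ultimately show ?thesis
    by (intro that[of M]) auto
qed

lemma run_exists:
  assumes "L0 > 0"
  shows "\<exists>s. is_run L0 s"
proof -
  \<comment> \<open>Dependent choice carries the two invariants under which the next inner loop
    terminates; the clause for \<open>k = 0\<close> pins the initial state.\<close>
  have "\<exists>s. \<forall>k. (valid_state (s k) \<and> L_est (s k) > 0 \<and> (k = 0 \<longrightarrow> s k = astm_init L0))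
      \<and> astm_inner \<phi> \<Lambda> (s k) (L_est (s k) / 2) (s (Suc k))"
  proof (rule dependent_nat_choice)
    show "\<exists>s. valid_state s \<and> L_est s > 0 \<and> ((0::nat) = 0 \<longrightarrow> s = astm_init L0)"
      using assms by (intro exI[of _ "astm_init L0"]) (simp add: valid_init, simp add: astm_init_def)
  next
    fix s :: "'v astm_state" and k :: nat
    assume s: "valid_state s \<and> L_est s > 0 \<and> (k = 0 \<longrightarrow> s = astm_init L0)"
    then obtain t where t: "astm_inner \<phi> \<Lambda> s (L_est s / 2) t"
      using inner_exists[of s "L_est s / 2"] by auto
    with s obtain M where "M > 0" "astm_trial \<phi> \<Lambda> s M t" "L_est t = M / 2"
      using inner_step by metis
    with s t show "\<exists>t. (valid_state t \<and> L_est t > 0 \<and> (Suc k = 0 \<longrightarrow> t = astm_init L0))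
        \<and> astm_inner \<phi> \<Lambda> s (L_est s / 2) t"
      using trial_valid by (intro exI[of _ t]) auto
  qed
  then show ?thesis
    unfolding is_run_def by blast
qed

lemma run_valid:
  assumes "is_run L0 s" "L0 > 0"
  shows "valid_state (s k) \<and> L_est (s k) > 0"
proof (induction k)
  case 0
  then show ?case
    using assms valid_init by (simp add: is_run_def) (simp add: astm_init_def)
next
  case (Suc k)
  obtain M where "M > 0" "astm_trial \<phi> \<Lambda> (s k) M (s (Suc k))" "L_est (s (Suc k)) = M / 2"
    using assms inner_step[of "s k" "s (Suc k)"] Suc unfolding is_run_def by metis
  then show ?case
    using trial_valid Suc by auto
qed

lemma run_step:
  assumes "is_run L0 s" "L0 > 0"
  obtains M where "M > 0" "astm_trial \<phi> \<Lambda> (s k) M (s (Suc k))" "astm_accept \<phi> M (s (Suc k))"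
    "M \<le> max (L_est (s k)) (2 * L)" "L_est (s (Suc k)) = M / 2"
  using assms inner_step[of "s k" "s (Suc k)"] run_valid[OF assms, of k] unfolding is_run_def by metis

lemma run_sum_alpha:
  assumes "is_run L0 s" "L0 > 0"
  shows "(\<Sum>i\<le>k. alpha (s i)) = C_sum (s k)"
proof (induction k)
  case 0
  then show ?case
    using assms by (simp add: is_run_def astm_init_def)
next
  case (Suc k)
  obtain M where "astm_trial \<phi> \<Lambda> (s k) M (s (Suc k))"
    using run_step[OF assms] by blast
  with Suc show ?case
    by (simp add: astm_trial_def)
qed

lemma run_alpha_nonneg:
  assumes "is_run L0 s" "L0 > 0"
  shows "alpha (s k) \<ge> 0"
proof (cases k)
  case 0
  then show ?thesis
    using assms by (simp add: is_run_def astm_init_def)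
next
  case (Suc n)
  obtain M where "M > 0" "astm_trial \<phi> \<Lambda> (s n) M (s (Suc n))"
    using run_step[OF assms] by blast
  with Suc show ?thesis
    using trial_C_sum(1) run_valid[OF assms, of n] by fastforce
qed

lemma run_estimate:
  assumes "is_run L0 s" "L0 > 0" "l \<in> \<Lambda>"
  shows "C_sum (s k) * \<phi> (eta (s k))
    \<le> (\<Sum>i\<le>k. alpha (s i) * (\<phi> (lam (s i)) + grad \<phi> (lam (s i)) \<bullet> (l - lam (s i))))
      + 1 / 2 * (norm l)\<^sup>2"
proof -
  \<comment> \<open>The distance to \<open>zeta (s k)\<close> is kept so that the step estimates
    telescope. Initially \<open>zeta\<close>, \<open>alpha\<close> and \<open>C_sum\<close> vanish,
    leaving \<open>1 / 2 * (norm l)\<^sup>2\<close>.\<close>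
  have "C_sum (s k) * \<phi> (eta (s k)) + 1 / 2 * (norm (l - zeta (s k)))\<^sup>2
    \<le> (\<Sum>i\<le>k. alpha (s i) * (\<phi> (lam (s i)) + grad \<phi> (lam (s i)) \<bullet> (l - lam (s i))))
      + 1 / 2 * (norm l)\<^sup>2"
  proof (induction k)
    case 0
    then show ?case
      using assms by (simp add: is_run_def astm_init_def)
  next
    case (Suc k)
    obtain M where "M > 0" "astm_trial \<phi> \<Lambda> (s k) M (s (Suc k))" "astm_accept \<phi> M (s (Suc k))"
      using run_step[OF assms(1,2)] by blast
    then show ?case
      using step_estimate[of "s k" M "s (Suc k)" l] Suc assms(3) run_valid[OF assms(1,2), of k]
      by simp
  qed
  then show ?thesis
    using zero_le_power2[of "norm (l - zeta (s k))"] by linarith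
qed

text \<open>Each step halves the accepted constant, which is at most \<open>4 * L\<close> in the
  first step and at most \<open>2 * L\<close> afterwards.\<close>

lemma run_L_est:
  assumes "is_run L0 s" "L0 > 0" "L0 \<le> 4 * L"
  shows "L_est (s k) \<le> (if k = 0 then 4 * L else 2 * L)"
proof (induction k)
  case 0
  then show ?case
    using assms by (simp add: is_run_def astm_init_def)
next
  case (Suc k)
  obtain M where "M \<le> max (L_est (s k)) (2 * L)" "L_est (s (Suc k)) = M / 2"
    using run_step[OF assms(1,2)] by blast
  with Suc L_pos show ?case
    by (simp split: if_splits)
qed

text \<open>The square root of \<open>C_sum\<close> grows by at least \<open>1 / (2 * S)\<close> per
  step, with \<open>S = sqrt (2 * L)\<close>.\<close>

lemma run_C_sum_growth:
  assumes "is_run L0 s" "L0 > 0" "L0 \<le> 4 * L"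
  shows "(real k)\<^sup>2 / (8 * L) \<le> C_sum (s k)"
proof -
  define S where "S = sqrt (2 * L)"
  have S: "S > 0" "S\<^sup>2 = 2 * L"
    using L_pos by (simp_all add: S_def)
  have nonneg: "C_sum (s k) \<ge> 0" for k
    using run_valid[OF assms(1,2), of k] by (simp add: valid_state_def)
  have "real k \<le> 2 * S * sqrt (C_sum (s k))"
  proof (induction k)
    case 0
    then show ?case
      using S nonneg[of 0] by simp
  next
    case (Suc k)
    obtain M where M: "M > 0" "astm_trial \<phi> \<Lambda> (s k) M (s (Suc k))"
        "M \<le> max (L_est (s k)) (2 * L)"
      using run_step[OF assms(1,2)] by blast
    define C C' \<alpha> where "C = C_sum (s k)" and "C' = C_sum (s (Suc k))" and "\<alpha> = alpha (s (Suc k))"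
    have C: "\<alpha> > 0" "C' > 0" "C' = C + \<alpha>" "C' = M * \<alpha>\<^sup>2"
      unfolding C_def C'_def \<alpha>_def
      using trial_C_sum[of "s k" M "s (Suc k)"] M run_valid[OF assms(1,2), of k] by auto
    have "1 \<le> 2 * S * (sqrt C' - sqrt C)"
    proof (cases "k = 0")
      \<comment> \<open>Only \<open>M <= 4 * L\<close> is known here, but \<open>C = 0\<close> makes
        \<open>C' = 1 / M\<close>, which exceeds the required \<open>1 / (8 * L)\<close>.\<close>
      case True
      then have "C = 0"
        using assms(1) by (simp add: C_def is_run_def astm_init_def)
      have "M \<le> 4 * L"
        using M(3) run_L_est[OF assms, of 0] True L_pos by simp
      moreover have "M * C' = 1"
      proof -
        have "C' = \<alpha>" "\<alpha> * (M * \<alpha>) = \<alpha>"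
          using C(3,4) \<open>C = 0\<close> by (simp_all add: power2_eq_square)
        with C(1) show ?thesis
          by simp
      qed
      ultimately have "1 \<le> 4 * L * C'"
        using mult_right_mono[of M "4 * L" C'] C(2) by simp
      also have "\<dots> \<le> 8 * L * C'"
        using C(2) L_pos by simp
      also have "\<dots> = (2 * S * sqrt C')\<^sup>2"
        using S C(2) by (simp add: power_mult_distrib)
      finally have "1\<^sup>2 \<le> (2 * S * sqrt C')\<^sup>2"
        by simp
      then have "1 \<le> 2 * S * sqrt C'"
        by (rule power2_le_imp_le) (use S C(2) in simp)
      then show ?thesis
        using \<open>C = 0\<close> by simp
    next
      case False
      then have "M \<le> S\<^sup>2"
        using M(3) run_L_est[OF assms, of k] S by simp
      then have "C' \<le> (S * \<alpha>)\<^sup>2"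
        using C(4) by (simp add: power_mult_distrib mult_right_mono)
      then have "sqrt C' \<le> S * \<alpha>"
        using S C(1) by (simp add: real_le_lsqrt)
      \<comment> \<open>Factoring \<open>C' - C\<close> as a difference of squares leaves a common
        factor \<open>sqrt C'\<close> to cancel.\<close>
      also have "\<alpha> = (sqrt C' - sqrt C) * (sqrt C' + sqrt C)"
        using C nonneg[of k] by (simp add: C_def[symmetric] algebra_simps)
      also have "\<dots> \<le> (sqrt C' - sqrt C) * (2 * sqrt C')"
        using C nonneg[of k] by (intro mult_left_mono) (auto simp: C_def)
      finally have "sqrt C' * 1 \<le> sqrt C' * (2 * S * (sqrt C' - sqrt C))"
        using S(1) by (simp add: mult_left_mono mult_ac)
      then show ?thesis
        using C(2) by simp
    qed
    with Suc show ?case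
      by (simp add: C_def C'_def algebra_simps)
  qed
  then have "(real k)\<^sup>2 \<le> (2 * S * sqrt (C_sum (s k)))\<^sup>2"
    by (intro power_mono) auto
  also have "\<dots> = 8 * L * C_sum (s k)"
    using S nonneg[of k] by (simp add: power_mult_distrib)
  finally show ?thesis
    using L_pos by (simp add: field_simps)
qed

end

section \<open>The dual function\<close>

lemma dual_cone_closed: "closed (dual_cone K)"
proof -
  have "dual_cone K = (\<Inter>x\<in>K. {l. l \<bullet> x \<ge> 0})"
    by (auto simp: dual_cone_def)
  then show ?thesis
    by (auto intro!: closed_INT closed_Collect_le continuous_intros)
qed

lemma dual_cone_convex: "convex (dual_cone K)"
  by (auto simp: dual_cone_def convex_def inner_add_left)

lemma dual_cone_zero: "0 \<in> dual_cone K"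
  by (simp add: dual_cone_def)

lemma dual_cone_scale: "l \<in> dual_cone K \<Longrightarrow> c \<ge> 0 \<Longrightarrow> c *\<^sub>R l \<in> dual_cone K"
  by (simp add: dual_cone_def)

text \<open>Bipolar theorem: a hyperplane separating \<open>v\<close> from \<open>K\<close> has its
  normal in the dual cone.\<close>

lemma dual_dual_cone_subset:
  fixes K :: "'h::euclidean_space set"
  assumes "K \<noteq> {}" "closed K" "convex K" "cone K"
    and "\<And>l. l \<in> dual_cone K \<Longrightarrow> l \<bullet> v \<ge> 0"
  shows "v \<in> K"
proof (rule ccontr)
  assume "v \<notin> K"
  then obtain a b where ab: "a \<bullet> v < b" "\<And>x. x \<in> K \<Longrightarrow> a \<bullet> x > b"
    using separating_hyperplane_closed_point[OF assms(3,2)] by blast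
  have "0 \<in> K"
    using assms cone_contains_0 by blast
  then have "b < 0"
    using ab(2)[of 0] by simp
  have "a \<bullet> x \<ge> 0" if "x \<in> K" for x
  proof (rule ccontr)
    assume neg: "\<not> a \<bullet> x \<ge> 0"
    \<comment> \<open>This multiple of \<open>x\<close> stays in the cone but lies on the separating
      hyperplane, contradicting strictness.\<close>
    define c where "c = b / (a \<bullet> x)"
    have "c \<ge> 0" "a \<bullet> (c *\<^sub>R x) = b"
      using neg \<open>b < 0\<close> by (simp_all add: c_def divide_nonpos_nonpos)
    then show False
      using ab(2)[of "c *\<^sub>R x"] mem_cone[OF assms(4) that] by simp
  qed
  then have "a \<bullet> v \<ge> 0"
    using assms(5) by (simp add: dual_cone_def)
  then show False
    using ab \<open>b < 0\<close> by simp
qed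

text \<open>Cauchy-Schwarz bounds the set, so the real supremum is a genuine one.\<close>

lemma cone_infeas_upper:
  assumes "l \<in> dual_cone K" "norm l \<le> 1"
  shows "l \<bullet> v \<le> cone_infeas K v"
  unfolding cone_infeas_def
proof (rule cSUP_upper)
  show "bdd_above ((\<lambda>l. l \<bullet> v) ` {l \<in> dual_cone K. norm l \<le> 1})"
  proof (rule bdd_aboveI2)
    fix l assume "l \<in> {l \<in> dual_cone K. norm l \<le> 1}"
    then show "l \<bullet> v \<le> 1 * norm v"
      using norm_cauchy_schwarz[of l v] mult_right_mono[of "norm l" 1 "norm v"] by simp
  qed
qed (use assms in auto)

lemma cone_infeas_nonneg: "cone_infeas K v \<ge> 0"
  using cone_infeas_upper[of 0 K v] by (simp add: dual_cone_zero)

lemma cone_infeas_scale: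
  assumes "l \<in> dual_cone K" "norm l \<le> R" "R > 0"
  shows "l \<bullet> v \<le> R * cone_infeas K v"
proof -
  have "((1 / R) *\<^sub>R l) \<bullet> v \<le> cone_infeas K v"
    using assms by (intro cone_infeas_upper dual_cone_scale) auto
  then show ?thesis
    using assms by (simp add: field_simps)
qed

lemma cone_infeas_least:
  assumes "\<And>l. l \<in> dual_cone K \<Longrightarrow> norm l \<le> 1 \<Longrightarrow> l \<bullet> v \<le> B"
  shows "cone_infeas K v \<le> B"
proof -
  have "0 \<in> {l \<in> dual_cone K. norm l \<le> 1}"
    by (simp add: dual_cone_zero)
  then show ?thesis
    unfolding cone_infeas_def by (intro cSUP_least) (use assms in auto)
qed

text \<open>\<open>unique_solution\<close> covers every \<open>l\<close>, dual feasible or not, so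
  the dual function is a maximum on the whole space.\<close>

locale conic_dual =
  fixes P :: "('e::real_normed_vector, 'h1::euclidean_space, 'h2::euclidean_space) conic_problem"
    and \<gamma> :: real
  assumes findim: "finite_dimensional TYPE('e)"
    and linear_eq: "linear (A_eq P)" and linear_in: "linear (A_in P)"
    and strongly_convex: "strongly_convex_on \<gamma> (feas_dom P) (objective P)"
    and unique_solution: "\<exists>!x. inner_solution P l x"
begin

abbreviation "f \<equiv> objective P"
abbreviation "\<phi> \<equiv> dual_fun P"
abbreviation "x_opt \<equiv> x_of P"

text \<open>\<open>l \<bullet> resid x - f x\<close> is the negative Lagrangian, and
  \<open>resid (x_opt l)\<close> will be the gradient of \<open>\<phi>\<close>.\<close>

definition resid :: "'e \<Rightarrow> 'h1 \<times> 'h2" where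
  "resid x = (b_eq P - A_eq P x, b_in P - A_in P x)"

definition A :: "'e \<Rightarrow> 'h1 \<times> 'h2" where
  "A x = (A_eq P x, A_in P x)"

lemma resid_eq: "resid x = (b_eq P, b_in P) - A x"
  by (simp add: resid_def A_def)

lemma linear_A: "linear A"
  using linear_eq linear_in unfolding A_def linear_iff by simp

lemma inner_obj_eq: "inner_obj P l x = l \<bullet> resid x - f x - l \<bullet> (b_eq P, b_in P)"
  by (simp add: inner_obj_def dual_adjoint_def resid_def inner_prod_def inner_diff_right)

lemma inner_solution_iff:
  "inner_solution P l x \<longleftrightarrow>
    x \<in> feas_dom P \<and> (\<forall>y\<in>feas_dom P. l \<bullet> resid y - f y \<le> l \<bullet> resid x - f x)"
  by (auto simp: inner_solution_def is_arg_max_linorder inner_obj_eq)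

lemma x_opt_solution: "inner_solution P l (x_opt l)"
  unfolding x_of_def by (rule theI'[OF unique_solution])

lemma x_opt_mem: "x_opt l \<in> feas_dom P"
  using x_opt_solution inner_solution_iff by blast

lemma dual_fun_eq: "\<phi> l = l \<bullet> resid (x_opt l) - f (x_opt l)"
proof -
  have "(SUP x\<in>feas_dom P. inner_obj P l x) = inner_obj P l (x_opt l)"
    using x_opt_solution[of l]
    by (intro cSup_eq_maximum) (auto simp: inner_solution_def is_arg_max_linorder)
  then show ?thesis
    by (simp add: dual_fun_def inner_obj_eq inner_prod_def)
qed

lemma dual_fun_ge: "x \<in> feas_dom P \<Longrightarrow> l \<bullet> resid x - f x \<le> \<phi> l"
  unfolding dual_fun_eq using x_opt_solution inner_solution_iff by blast

text \<open>\<open>\<phi>\<close> is a maximum of affine functions; the one indexed by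
  \<open>x_opt l\<close> touches it at \<open>l\<close>.\<close>

lemma dual_fun_lower: "\<phi> l + resid (x_opt l) \<bullet> (m - l) \<le> \<phi> m"
  using dual_fun_ge[OF x_opt_mem, of m l] dual_fun_eq[of l]
  by (simp add: inner_diff_right inner_commute[of "resid (x_opt l)"])

text \<open>The functional \<open>x \<mapsto> - \<langle>l, A x\<rangle>\<close> is a subgradient of \<open>f\<close> at \<open>x(l)\<close>, so strong
  convexity applies there.\<close>

lemma quadratic_growth:
  assumes "y \<in> feas_dom P"
  shows "l \<bullet> resid y - f y + \<gamma> / 2 * (norm (x_opt l - y))\<^sup>2 \<le> \<phi> l"
proof -
  have "linear (\<lambda>x. - (l \<bullet> A x))"
    using linear_A by (auto simp: linear_iff inner_add_right)
  moreover have "f z \<ge> f (x_opt l) + - (l \<bullet> A (z - x_opt l))" if "z \<in> feas_dom P" for z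
    using dual_fun_ge[OF that, of l] dual_fun_eq[of l]
    by (simp add: resid_eq linear_diff[OF linear_A] inner_diff_right)
  ultimately have "subgradient_on (feas_dom P) f (x_opt l) (\<lambda>x. - (l \<bullet> A x))"
    by (simp add: subgradient_on_def)
  then have "f y \<ge> f (x_opt l) + - (l \<bullet> A (y - x_opt l)) + \<gamma> / 2 * (norm (x_opt l - y))\<^sup>2"
    using strongly_convex x_opt_mem assms unfolding strongly_convex_on_def by blast
  then show ?thesis
    by (simp add: dual_fun_eq resid_eq linear_diff[OF linear_A] inner_diff_right)
qed

lemma dual_fun_gderiv: "GDERIV \<phi> l :> resid (x_opt l)"
proof -
  have "\<gamma> > 0"
    using strongly_convex by (simp add: strongly_convex_on_def)
  obtain B where B: "B > 0" "\<And>x. norm (A x) \<le> B * norm x"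
    using bounded_linear.pos_bounded[OF finite_dimensional_linear_imp_bounded_linear[OF findim linear_A]]
    by (auto simp: mult.commute)
  show ?thesis
  \<comment> \<open>The constant is the maximum of
    \<open>n * (B * d) - \<gamma> / 2 * d\<^sup>2\<close> over \<open>d\<close>, divided by
    \<open>n\<^sup>2\<close>.\<close>
  proof (rule GDERIV_I_quadratic[where c = "B\<^sup>2 / (2 * \<gamma>)"])
    fix m
    show "\<phi> m \<ge> \<phi> l + resid (x_opt l) \<bullet> (m - l)"
      by (rule dual_fun_lower)
    define d where "d = norm (x_opt l - x_opt m)"
    define n where "n = norm (m - l)"
    have "\<phi> m - \<phi> l - resid (x_opt l) \<bullet> (m - l) + \<gamma> / 2 * d\<^sup>2
        \<le> (m - l) \<bullet> (A (x_opt l - x_opt m))"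
      using quadratic_growth[OF x_opt_mem, of l m] dual_fun_eq[of m]
      by (simp add: d_def resid_eq linear_diff[OF linear_A] inner_diff_right inner_diff_left inner_commute)
    also have "\<dots> \<le> n * (B * d)"
      using norm_cauchy_schwarz[of "m - l" "A (x_opt l - x_opt m)"] B(2)[of "x_opt l - x_opt m"]
      by (fastforce simp: n_def d_def intro: order_trans mult_left_mono)
    also have "\<dots> \<le> B\<^sup>2 / (2 * \<gamma>) * n\<^sup>2 + \<gamma> / 2 * d\<^sup>2"
    proof -
      have "0 \<le> (B * n - \<gamma> * d)\<^sup>2 / (2 * \<gamma>)"
        using \<open>\<gamma> > 0\<close> by simp
      also have "\<dots> = B\<^sup>2 / (2 * \<gamma>) * n\<^sup>2 + \<gamma> / 2 * d\<^sup>2 - n * (B * d)"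
        using \<open>\<gamma> > 0\<close> by (simp add: field_simps power2_eq_square)
      finally show ?thesis
        by simp
    qed
    finally show "\<phi> m \<le> \<phi> l + resid (x_opt l) \<bullet> (m - l) + B\<^sup>2 / (2 * \<gamma>) * (norm (m - l))\<^sup>2"
      by (simp add: n_def)
  qed
qed

lemma grad_dual_fun: "grad \<phi> l = resid (x_opt l)"
  by (rule grad_eq[OF dual_fun_gderiv])

text \<open>Linearizing \<open>\<phi>\<close> at \<open>l\<close> fixes \<open>x_opt l\<close> in
  the Lagrangian and varies only the multiplier.\<close>

lemma dual_linearization: "\<phi> l + grad \<phi> l \<bullet> (m - l) = m \<bullet> resid (x_opt l) - f (x_opt l)"
  by (simp add: grad_dual_fun dual_fun_eq inner_diff_right inner_commute[of "resid (x_opt l)"])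

lemma resid_weighted_sum:
  assumes "finite I" "sum c I = 1"
  shows "resid (\<Sum>i\<in>I. c i *\<^sub>R x i) = (\<Sum>i\<in>I. c i *\<^sub>R resid (x i))"
proof -
  have "(\<Sum>i\<in>I. c i *\<^sub>R b) = b" for b :: "'h1 \<times> 'h2"
    using assms by (simp flip: scaleR_sum_left)
  then show ?thesis
    by (simp add: resid_eq linear_sum[OF linear_A] linear_scale[OF linear_A] scaleR_diff_right
        sum_subtractf del: scaleR_Pair)
qed

text \<open>\<open>resid\<close> is affine and \<open>f\<close> convex, so averaging the
  linearizations yields at most the negative Lagrangian at the averaged point.\<close>

lemma lagrangian_jensen:
  assumes "finite I" "I \<noteq> {}" "sum c I = 1" "\<And>i. i \<in> I \<Longrightarrow> c i \<ge> 0"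
  shows "(\<Sum>i\<in>I. c i * (\<phi> (l i) + grad \<phi> (l i) \<bullet> (m - l i)))
    \<le> m \<bullet> resid (\<Sum>i\<in>I. c i *\<^sub>R x_opt (l i)) - f (\<Sum>i\<in>I. c i *\<^sub>R x_opt (l i))"
proof -
  have "f (\<Sum>i\<in>I. c i *\<^sub>R x_opt (l i)) \<le> (\<Sum>i\<in>I. c i * f (x_opt (l i)))"
    using strongly_convex x_opt_mem assms unfolding strongly_convex_on_def
    by (intro convex_on_sum[where C = "feas_dom P"]) auto
  then show ?thesis
    unfolding dual_linearization resid_weighted_sum[OF assms(1,3)]
    by (simp add: inner_sum_right right_diff_distrib sum_subtractf)
qed

lemma dual_feas_closed: "closed (dual_feas P)"
proof -
  have "dual_feas P = UNIV \<times> dual_cone (in_cone P)"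
    by (auto simp: dual_feas_def)
  then show ?thesis
    by (simp add: closed_Times dual_cone_closed)
qed

lemma dual_feas_convex: "convex (dual_feas P)"
proof -
  have "dual_feas P = UNIV \<times> dual_cone (in_cone P)"
    by (auto simp: dual_feas_def)
  then show ?thesis
    by (simp add: convex_Times dual_cone_convex)
qed

lemma dual_feas_zero: "0 \<in> dual_feas P"
  by (simp add: dual_feas_def dual_cone_zero)

lemma similar_triangles_dual:
  assumes "L > 0" "L-lipschitz_on UNIV (grad \<phi>)"
  shows "similar_triangles \<phi> (dual_feas P) L"
  using assms dual_fun_gderiv dual_fun_lower dual_feas_closed dual_feas_convex dual_feas_zero
  by unfold_locales (simp_all add: grad_dual_fun)

section \<open>Strong duality\<close>

lemma dual_solution_optimality:
  assumes "dual_solution P lstar" "l \<in> dual_feas P"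
  shows "resid (x_opt lstar) \<bullet> (l - lstar) \<ge> 0"
proof -
  define h where "h t = \<phi> (lstar + t *\<^sub>R (l - lstar))" for t
  have star: "lstar \<in> dual_feas P" "\<And>m. m \<in> dual_feas P \<Longrightarrow> \<phi> lstar \<le> \<phi> m"
    using assms(1) by (auto simp: dual_solution_def is_arg_max_linorder)
  have "((\<lambda>t. lstar + t *\<^sub>R (l - lstar)) has_derivative (\<lambda>s. s *\<^sub>R (l - lstar))) (at 0)"
    by (auto intro!: derivative_eq_intros)
  moreover have "(\<phi> has_derivative (\<lambda>v. v \<bullet> resid (x_opt lstar))) (at (lstar + 0 *\<^sub>R (l - lstar)))"
    using dual_fun_gderiv[of lstar] by (simp add: gderiv_def)
  ultimately have "(h has_derivative (\<lambda>s. (s *\<^sub>R (l - lstar)) \<bullet> resid (x_opt lstar))) (at 0)"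
    unfolding h_def by (rule has_derivative_compose)
  then have D: "DERIV h 0 :> resid (x_opt lstar) \<bullet> (l - lstar)"
    by (rule has_derivative_imp_has_field_derivative) (simp add: inner_commute mult.commute)
  show ?thesis
  proof (rule ccontr)
    assume "\<not> ?thesis"
    then obtain d where d: "d > 0" "\<And>t. 0 < t \<Longrightarrow> t < d \<Longrightarrow> h t < h 0"
      using DERIV_neg_dec_right[OF D] by auto
    \<comment> \<open>Small enough for strict decrease of \<open>h\<close>, and at most 1 to stay on
      the segment inside \<open>dual_feas P\<close>.\<close>
    define t where "t = min 1 (d / 2)"
    have t: "0 < t" "t < d" "t \<le> 1"
      using d by (auto simp: t_def)
    have "lstar + t *\<^sub>R (l - lstar) = (1 - t) *\<^sub>R lstar + t *\<^sub>R l"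
      by (simp add: algebra_simps)
    then have "lstar + t *\<^sub>R (l - lstar) \<in> dual_feas P"
      using convexD_alt[OF dual_feas_convex star(1) assms(2), of t] t by simp
    then show False
      using star(2) d(2)[of t] t by (fastforce simp: h_def)
  qed
qed

text \<open>The optimality conditions make \<open>x_opt lstar\<close> feasible and complementary to
  \<open>lstar\<close>; weak duality shows that no feasible point does better.\<close>

lemma opt_value_eq:
  assumes cone: "in_cone P \<noteq> {}" "closed (in_cone P)" "convex (in_cone P)" "cone (in_cone P)"
    and sol: "dual_solution P lstar"
  shows "opt_value P = - \<phi> lstar"
proof -
  define x where "x = x_opt lstar"
  note opt = dual_solution_optimality[OF sol, folded x_def]
  have star: "lstar \<in> dual_feas P"
    using sol by (simp add: dual_solution_def is_arg_max_linorder)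
  \<comment> \<open>Adding feasible directions to \<open>lstar\<close> turns the variational
    inequality into nonnegativity on the whole dual cone.\<close>
  have add_mem: "lstar + m \<in> dual_feas P" if "m \<in> dual_feas P" for m
    using star that by (simp add: dual_feas_def dual_cone_def inner_add_left)
  have ge: "resid x \<bullet> m \<ge> 0" if "m \<in> dual_feas P" for m
    using opt[OF add_mem[OF that]] by simp
  have "resid x \<bullet> lstar = 0"
    using opt[OF dual_feas_zero] ge[OF star] by simp
  then have fx: "f x = - \<phi> lstar"
    by (simp add: dual_fun_eq x_def inner_commute)
  \<comment> \<open>The first block is free in sign, so testing with the negative residual forces it
    to vanish.\<close>
  have mem: "(- fst (resid x), 0) \<in> dual_feas P"
    by (simp add: dual_feas_def dual_cone_zero)
  have "fst (resid x) \<bullet> fst (resid x) \<le> 0"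
    using ge[OF mem] by (simp add: inner_prod_def)
  then have "fst (resid x) = 0"
    by (metis inner_ge_zero inner_eq_zero_iff order_antisym)
  then have "A_eq P x = b_eq P"
    by (simp add: resid_def)
  moreover have "l \<bullet> snd (resid x) \<ge> 0" if "l \<in> dual_cone (in_cone P)" for l
    using ge[of "(0, l)"] that by (simp add: dual_feas_def inner_prod_def inner_commute)
  then have "b_in P - A_in P x \<in> in_cone P"
    using dual_dual_cone_subset[OF cone, of "snd (resid x)"] by (simp add: resid_def)
  then have "A_in P x - b_in P \<in> uminus ` in_cone P"
    by (intro image_eqI[of _ _ "b_in P - A_in P x"]) auto
  ultimately have "x \<in> feasible_set P"
    by (simp add: feasible_set_def x_def x_opt_mem)
  moreover have "f x \<le> f y" if "y \<in> feasible_set P" for y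
  proof -
    have y: "y \<in> feas_dom P" "A_eq P y = b_eq P" "b_in P - A_in P y \<in> in_cone P"
      using that by (auto simp: feasible_set_def) (metis minus_diff_eq minus_minus)
    have "lstar \<bullet> resid y \<ge> 0"
      using y star by (auto simp: resid_def inner_prod_def dual_feas_def dual_cone_def)
    then show ?thesis
      using dual_fun_ge[OF y(1), of lstar] fx by simp
  qed
  ultimately show ?thesis
    unfolding opt_value_def fx[symmetric] by (intro cInf_eq_minimum) auto
qed

section \<open>Convergence rate\<close>

text \<open>Weak duality at \<open>lstar\<close>, with its pairing with the residual estimated block
  by block.\<close>

lemma primal_dual_gap_lower:
  assumes "x \<in> feas_dom P" "lstar \<in> dual_feas P"
    and "norm (fst lstar) \<le> R1" "norm (snd lstar) \<le> R2" "R2 > 0"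
  shows "f x + \<phi> lstar \<ge> - R1 * norm (A_eq P x - b_eq P) - R2 * cone_infeas (in_cone P) (A_in P x - b_in P)"
proof -
  have "fst lstar \<bullet> (A_eq P x - b_eq P) \<le> R1 * norm (A_eq P x - b_eq P)"
    using norm_cauchy_schwarz[of "fst lstar" "A_eq P x - b_eq P"] assms(3)
    by (meson mult_right_mono norm_ge_zero order_trans)
  moreover have "snd lstar \<bullet> (A_in P x - b_in P) \<le> R2 * cone_infeas (in_cone P) (A_in P x - b_in P)"
    using assms by (intro cone_infeas_scale) (auto simp: dual_feas_def)
  moreover have "lstar \<bullet> resid x = - (fst lstar \<bullet> (A_eq P x - b_eq P)) - snd lstar \<bullet> (A_in P x - b_in P)"
    by (simp add: resid_def inner_prod_def inner_diff_right)
  ultimately show ?thesis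
    using dual_fun_ge[OF assms(1), of lstar] by simp
qed

text \<open>The bound is the value of the hypothesis at the dual point with blocks
  \<open>2 R\<^sub>1 u\<close> and \<open>2 R\<^sub>2 l\<close>, where \<open>u\<close> and \<open>l\<close> are unit vectors attaining
  \<open>\<parallel>A\<^sub>1 x - b\<^sub>1\<parallel>\<close> and (nearly) \<open>\<rho>(A\<^sub>2 x - b\<^sub>2, -K)\<close>.\<close>

lemma primal_dual_gap_upper:
  assumes bound: "\<And>l. l \<in> dual_feas P \<Longrightarrow> g \<le> l \<bullet> resid x + (norm l)\<^sup>2 / (2 * C)"
    and pos: "C > 0" "R1 > 0" "R2 > 0"
  shows "g + 2 * R1 * norm (A_eq P x - b_eq P) + 2 * R2 * cone_infeas (in_cone P) (A_in P x - b_in P)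
    \<le> 2 * (R1\<^sup>2 + R2\<^sup>2) / C"
proof -
  define v1 v2 where "v1 = A_eq P x - b_eq P" and "v2 = A_in P x - b_in P"
  \<comment> \<open>The hypothesis at the test point, solved for \<open>l \<bullet> v2\<close>; the
    supremum over \<open>l\<close> inherits the bound.\<close>
  define B where "B = (2 * (R1\<^sup>2 + R2\<^sup>2) / C - g - 2 * R1 * norm v1) / (2 * R2)"
  have "l \<bullet> v2 \<le> B" if l: "l \<in> dual_cone (in_cone P)" "norm l \<le> 1" for l
  proof -
    \<comment> \<open>For \<open>v1 = 0\<close> the value \<open>sgn v1\<close> is 0, which still
      satisfies the norm bound and the pairing identity.\<close>
    define m where "m = ((2 * R1) *\<^sub>R sgn v1, (2 * R2) *\<^sub>R l)"
    have "m \<in> dual_feas P"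
      using l pos by (simp add: m_def dual_feas_def dual_cone_scale)
    then have "g \<le> m \<bullet> resid x + (norm m)\<^sup>2 / (2 * C)"
      by (rule bound)
    also have "m \<bullet> resid x = - 2 * R1 * norm v1 - 2 * R2 * (l \<bullet> v2)"
    proof -
      have "sgn v1 \<bullet> v1 = norm v1"
        by (cases "v1 = 0") (simp_all add: sgn_div_norm dot_square_norm power2_eq_square)
      moreover have "resid x = (- v1, - v2)"
        by (simp add: resid_def v1_def v2_def)
      ultimately show ?thesis
        by (simp add: m_def)
    qed
    also have "(norm m)\<^sup>2 / (2 * C) \<le> 4 * (R1\<^sup>2 + R2\<^sup>2) / (2 * C)"
    proof -
      have "(norm (sgn v1))\<^sup>2 \<le> 1" "(norm l)\<^sup>2 \<le> 1"
        using l by (simp_all add: norm_sgn power_le_one)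
      then have "(2 * R1)\<^sup>2 * (norm (sgn v1))\<^sup>2 + (2 * R2)\<^sup>2 * (norm l)\<^sup>2 \<le> (2 * R1)\<^sup>2 * 1 + (2 * R2)\<^sup>2 * 1"
        by (intro add_mono mult_left_mono) auto
      then have "(norm m)\<^sup>2 \<le> 4 * (R1\<^sup>2 + R2\<^sup>2)"
        by (simp add: m_def norm_Pair power_mult_distrib)
      then show ?thesis
        using pos by (intro divide_right_mono) auto
    qed
    finally show ?thesis
      using pos by (simp add: B_def pos_le_divide_eq algebra_simps)
  qed
  then have "cone_infeas (in_cone P) v2 \<le> B"
    by (rule cone_infeas_least)
  then show ?thesis
    using pos unfolding B_def v1_def[symmetric] v2_def[symmetric]
    by (simp add: pos_le_divide_eq algebra_simps)
qed

lemma pdastm_rate: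
  assumes lip: "L > 0" "L-lipschitz_on UNIV (grad \<phi>)"
    and run: "pdastm_run P L0 s" "L0 > 0" "L0 \<le> 4 * L"
    and sol: "dual_solution P lstar" "norm (fst lstar) \<le> R1" "norm (snd lstar) \<le> R2"
    and R: "R1 > 0" "R2 > 0" and "k \<ge> 1"
  defines "T \<equiv> 16 * L * (R1\<^sup>2 + R2\<^sup>2) / (real k)\<^sup>2"
  shows "\<bar>f (x_hat P s k) + \<phi> (eta (s k))\<bar> \<le> T" (is ?thesis1)
    and "\<bar>f (x_hat P s k) + \<phi> lstar\<bar> \<le> T" (is ?thesis2)
    and "norm (A_eq P (x_hat P s k) - b_eq P) \<le> T / R1" (is ?thesis3)
    and "cone_infeas (in_cone P) (A_in P (x_hat P s k) - b_in P) \<le> T / R2" (is ?thesis4)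
proof -
  interpret ST: similar_triangles \<phi> "dual_feas P" L
    using lip by (rule similar_triangles_dual)
  have is_run: "ST.is_run L0 s"
    using run(1) by (simp add: pdastm_run_def ST.is_run_def)
  note growth = ST.run_C_sum_growth[OF is_run run(2,3), of k]
  define C where "C = C_sum (s k)"
  have "(real k)\<^sup>2 / (8 * L) > 0"
    using \<open>k \<ge> 1\<close> lip by simp
  then have "C > 0"
    using growth by (simp add: C_def)
  define c where "c i = alpha (s i) / C" for i
  define x where "x = x_hat P s k"
  have x: "x = (\<Sum>i\<le>k. c i *\<^sub>R x_opt (lam (s i)))"
    by (simp add: x_def x_hat_def C_def c_def scaleR_sum_right)
  have c: "(\<Sum>i\<le>k. c i) = 1" "\<And>i. c i \<ge> 0"
    using ST.run_sum_alpha[OF is_run run(2), of k] ST.run_alpha_nonneg[OF is_run run(2)] \<open>C > 0\<close>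
    by (simp_all add: c_def C_def flip: sum_divide_distrib)
  have "x \<in> feas_dom P"
    unfolding x using c x_opt_mem strongly_convex
    by (intro convex_sum) (auto simp: strongly_convex_on_def convex_on_def)
  have star: "lstar \<in> dual_feas P" "\<phi> lstar \<le> \<phi> (eta (s k))"
    using sol(1) ST.run_valid[OF is_run run(2), of k]
    unfolding dual_solution_def is_arg_max_linorder ST.valid_state_def neg_le_iff_le by blast+
  define g where "g = f x + \<phi> (eta (s k))"
  have "g \<le> l \<bullet> resid x + (norm l)\<^sup>2 / (2 * C)" if "l \<in> dual_feas P" for l
  proof -
    have "\<phi> (eta (s k)) \<le> ((\<Sum>i\<le>k. alpha (s i) * (\<phi> (lam (s i)) + grad \<phi> (lam (s i)) \<bullet> (l - lam (s i))))
        + 1 / 2 * (norm l)\<^sup>2) / C"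
      using ST.run_estimate[OF is_run run(2) that, of k] \<open>C > 0\<close>
      by (simp add: C_def pos_le_divide_eq mult.commute)
    also have "\<dots> = (\<Sum>i\<le>k. c i * (\<phi> (lam (s i)) + grad \<phi> (lam (s i)) \<bullet> (l - lam (s i))))
        + (norm l)\<^sup>2 / (2 * C)"
      by (simp add: c_def add_divide_distrib sum_divide_distrib)
    also have "\<dots> \<le> l \<bullet> resid x - f x + (norm l)\<^sup>2 / (2 * C)"
      unfolding x using lagrangian_jensen[of "{..k}" c "\<lambda>i. lam (s i)" l] c by simp
    finally show ?thesis
      by (simp add: g_def)
  qed
  note upper = primal_dual_gap_upper[OF this \<open>C > 0\<close> R]
  \<comment> \<open>The growth bound replaces \<open>1 / C\<close> by at most
    \<open>8 * L / (real k)\<^sup>2\<close>, which produces the factor 16.\<close>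
  have CT: "2 * (R1\<^sup>2 + R2\<^sup>2) / C \<le> T"
  proof -
    have "2 * (R1\<^sup>2 + R2\<^sup>2) / C \<le> 2 * (R1\<^sup>2 + R2\<^sup>2) / ((real k)\<^sup>2 / (8 * L))"
      using growth \<open>(real k)\<^sup>2 / (8 * L) > 0\<close> \<open>C > 0\<close>
      by (intro divide_left_mono mult_pos_pos) (simp_all add: C_def)
    also have "\<dots> = T"
      by (simp add: T_def)
    finally show ?thesis .
  qed
  define u w where "u = R1 * norm (A_eq P x - b_eq P)"
    and "w = R2 * cone_infeas (in_cone P) (A_in P x - b_in P)"
  have "u \<ge> 0" "w \<ge> 0"
    using R by (simp_all add: u_def w_def cone_infeas_nonneg)
  moreover have "g + 2 * u + 2 * w \<le> T"
    using upper CT by (simp add: u_def w_def)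
  moreover have "f x + \<phi> lstar \<ge> - u - w"
    using primal_dual_gap_lower[OF \<open>x \<in> feas_dom P\<close> star(1) sol(2,3) R(2)] by (simp add: u_def w_def)
  moreover have "f x + \<phi> lstar \<le> g"
    using star(2) by (simp add: g_def)
  \<comment> \<open>Since \<open>g >= - u - w\<close>, the doubled radii leave
    \<open>u + w <= T\<close>, and then \<open>g >= - T\<close>.\<close>
  ultimately have "\<bar>g\<bar> \<le> T" "\<bar>f x + \<phi> lstar\<bar> \<le> T" "u \<le> T" "w \<le> T"
    by linarith+
  then show ?thesis1 ?thesis2 ?thesis3 ?thesis4
    using R unfolding g_def u_def w_def x_def by (simp_all add: pos_le_divide_eq mult.commute)
qed

end

lemma divide_square_le_of_sqrt_le:
  assumes "sqrt (a / e) \<le> real k" "e > 0" "k \<ge> 1"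
  shows "a / (real k)\<^sup>2 \<le> e"
  using sqrt_le_D[OF assms(1)] assms by (simp add: field_simps)

text \<open>The rate is inverted at the stated iteration numbers; existence of a run shows that the
  inner loop can be completed at every iteration.\<close>

theorem theorem2:
  fixes P :: "('e::real_normed_vector, 'h1::euclidean_space, 'h2::euclidean_space) conic_problem"
    and \<gamma> L L0 R1 R2 :: real
    and lstar :: "'h1 \<times> 'h2"
  assumes "finite_dimensional TYPE('e)"
    and "closed (feas_dom P)" and "convex (feas_dom P)"
    and "linear (A_eq P)" and "linear (A_in P)"
    and "in_cone P \<noteq> {}" and "closed (in_cone P)" and "convex (in_cone P)" and "cone (in_cone P)"
    and "strongly_convex_on \<gamma> (feas_dom P) (objective P)"
    and "\<forall>l. \<exists>!x. inner_solution P l x"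
    and "L > 0" and "L-lipschitz_on UNIV (grad (dual_fun P))"
    and "L0 > 0" and "L0 \<le> 4 * L"
    and "dual_solution P lstar"
    and "R1 > 0" and "R2 > 0" and "norm (fst lstar) \<le> R1" and "norm (snd lstar) \<le> R2"
  shows
    "(\<exists>s. pdastm_run P L0 s) \<and>
     (\<forall>s. pdastm_run P L0 s \<longrightarrow>
       (\<forall>\<epsilon>f > 0. \<forall>\<epsilon>eq > 0. \<forall>\<epsilon>in > 0.
          \<exists>k \<ge> 1. int k \<le> max \<lceil>sqrt (16 * L * (R1\<^sup>2 + R2\<^sup>2) / \<epsilon>f)\<rceil>
                        (max \<lceil>sqrt (16 * L * (R1\<^sup>2 + R2\<^sup>2) / (R1 * \<epsilon>eq))\<rceil>
                             \<lceil>sqrt (16 * L * (R1\<^sup>2 + R2\<^sup>2) / (R2 * \<epsilon>in))\<rceil>)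
            \<and> pdastm_stop P \<epsilon>f \<epsilon>eq \<epsilon>in s k) \<and>
       (\<forall>\<epsilon>f > 0. \<forall>\<epsilon>eq > 0. \<forall>\<epsilon>in > 0. \<forall>k.
          int k = max \<lceil>sqrt (32 * L * (R1\<^sup>2 + R2\<^sup>2) / \<epsilon>f)\<rceil>
                 (max \<lceil>sqrt (16 * L * (R1\<^sup>2 + R2\<^sup>2) / (R1 * \<epsilon>eq))\<rceil>
                      \<lceil>sqrt (16 * L * (R1\<^sup>2 + R2\<^sup>2) / (R2 * \<epsilon>in))\<rceil>)
          \<longrightarrow> eps_solution P \<epsilon>f \<epsilon>eq \<epsilon>in (x_hat P s (k + 1))))"
proof -
  interpret conic_dual P \<gamma>
    by (intro conic_dual.intro assms assms(11)[rule_format])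
  interpret ST: similar_triangles "dual_fun P" "dual_feas P" L
    by (rule similar_triangles_dual[OF assms(12,13)])
  define W where "W = 16 * L * (R1\<^sup>2 + R2\<^sup>2)"
  have "W > 0"
    using assms by (simp add: W_def pos_add_strict)
  have W2: "32 * L * (R1\<^sup>2 + R2\<^sup>2) = 2 * W"
    by (simp add: W_def)
  have rate: "\<bar>objective P (x_hat P s k) + dual_fun P (eta (s k))\<bar> \<le> \<epsilon>f"
      "\<bar>objective P (x_hat P s k) - opt_value P\<bar> \<le> \<epsilon>f"
      "norm (A_eq P (x_hat P s k) - b_eq P) \<le> \<epsilon>eq"
      "cone_infeas (in_cone P) (A_in P (x_hat P s k) - b_in P) \<le> \<epsilon>in"
    if run: "pdastm_run P L0 s" and pos: "\<epsilon>f > 0" "\<epsilon>eq > 0" "\<epsilon>in > 0" and k: "k \<ge> 1"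
      and large: "sqrt (W / \<epsilon>f) \<le> real k" "sqrt (W / (R1 * \<epsilon>eq)) \<le> real k" "sqrt (W / (R2 * \<epsilon>in)) \<le> real k"
    for s k \<epsilon>f \<epsilon>eq \<epsilon>in
  proof -
    note bounds = pdastm_rate[OF assms(12,13) run assms(14-16,19,20,17,18) k, folded W_def]
    have "W / (real k)\<^sup>2 \<le> \<epsilon>f" "W / (real k)\<^sup>2 \<le> R1 * \<epsilon>eq" "W / (real k)\<^sup>2 \<le> R2 * \<epsilon>in"
      using large pos k assms(17,18) by (auto intro: divide_square_le_of_sqrt_le)
    then have "W / (real k)\<^sup>2 \<le> \<epsilon>f" "W / (real k)\<^sup>2 / R1 \<le> \<epsilon>eq" "W / (real k)\<^sup>2 / R2 \<le> \<epsilon>in"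
      using assms(17,18) by (simp_all add: pos_divide_le_eq mult.commute del: divide_divide_eq_left)
    with bounds opt_value_eq[OF assms(6-9,16)]
    show "\<bar>objective P (x_hat P s k) + dual_fun P (eta (s k))\<bar> \<le> \<epsilon>f"
      "\<bar>objective P (x_hat P s k) - opt_value P\<bar> \<le> \<epsilon>f"
      "norm (A_eq P (x_hat P s k) - b_eq P) \<le> \<epsilon>eq"
      "cone_infeas (in_cone P) (A_in P (x_hat P s k) - b_in P) \<le> \<epsilon>in"
      by linarith+
  qed
  have "\<exists>s. pdastm_run P L0 s"
    using ST.run_exists assms(14) by (simp add: ST.is_run_def pdastm_run_def)
  moreover have "\<exists>k \<ge> 1. int k \<le> max \<lceil>sqrt (W / \<epsilon>f)\<rceil> (max \<lceil>sqrt (W / (R1 * \<epsilon>eq))\<rceil> \<lceil>sqrt (W / (R2 * \<epsilon>in))\<rceil>)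
            \<and> pdastm_stop P \<epsilon>f \<epsilon>eq \<epsilon>in s k"
    if run: "pdastm_run P L0 s" and pos: "\<epsilon>f > 0" "\<epsilon>eq > 0" "\<epsilon>in > 0" for s \<epsilon>f \<epsilon>eq \<epsilon>in
  proof -
    define N where "N = max \<lceil>sqrt (W / \<epsilon>f)\<rceil> (max \<lceil>sqrt (W / (R1 * \<epsilon>eq))\<rceil> \<lceil>sqrt (W / (R2 * \<epsilon>in))\<rceil>)"
    \<comment> \<open>Positivity of the ceiling makes \<open>nat N\<close> at least 1, as the rate
      requires.\<close>
    have "\<lceil>sqrt (W / \<epsilon>f)\<rceil> > 0"
      using \<open>W > 0\<close> pos by simp
    then have "N > 0"
      unfolding N_def less_max_iff_disj by blast
    have "sqrt (W / \<epsilon>f) \<le> of_int N" "sqrt (W / (R1 * \<epsilon>eq)) \<le> of_int N" "sqrt (W / (R2 * \<epsilon>in)) \<le> of_int N"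
      unfolding ceiling_le_iff[symmetric] N_def by auto
    then have "pdastm_stop P \<epsilon>f \<epsilon>eq \<epsilon>in s (nat N)"
      unfolding pdastm_stop_def using rate[OF run pos, of "nat N"] \<open>N > 0\<close> by simp
    with \<open>N > 0\<close> show ?thesis
      unfolding N_def[symmetric] by (intro exI[of _ "nat N"]) simp
  qed
  moreover have "eps_solution P \<epsilon>f \<epsilon>eq \<epsilon>in (x_hat P s (k + 1))"
    if run: "pdastm_run P L0 s" and pos: "\<epsilon>f > 0" "\<epsilon>eq > 0" "\<epsilon>in > 0"
      and k: "int k = max \<lceil>sqrt (2 * W / \<epsilon>f)\<rceil> (max \<lceil>sqrt (W / (R1 * \<epsilon>eq))\<rceil> \<lceil>sqrt (W / (R2 * \<epsilon>in))\<rceil>)"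
    for s \<epsilon>f \<epsilon>eq \<epsilon>in k
  proof -
    have "sqrt (2 * W / \<epsilon>f) \<le> of_int (int k)" "sqrt (W / (R1 * \<epsilon>eq)) \<le> of_int (int k)"
      "sqrt (W / (R2 * \<epsilon>in)) \<le> of_int (int k)"
      unfolding ceiling_le_iff[symmetric] k by auto
    \<comment> \<open>The threshold with \<open>2 * W\<close> dominates the one with
      \<open>W\<close>, and passing from \<open>k\<close> to \<open>k + 1\<close> preserves all
      three bounds.\<close>
    moreover have "sqrt (W / \<epsilon>f) \<le> sqrt (2 * W / \<epsilon>f)"
      using \<open>W > 0\<close> pos by (simp add: divide_right_mono)
    ultimately have "sqrt (W / \<epsilon>f) \<le> real (k + 1)" "sqrt (W / (R1 * \<epsilon>eq)) \<le> real (k + 1)"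
      "sqrt (W / (R2 * \<epsilon>in)) \<le> real (k + 1)"
      by linarith+
    then show ?thesis
      unfolding eps_solution_def using rate(2-4)[OF run pos, of "k + 1"] by simp
  qed
  ultimately show ?thesis
    unfolding W2 W_def[symmetric] by blast
qed

end
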